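(* Suppose that $\theta$ is a large enough regular cardinal, that $(X,\tau)\in H(\theta)$ is a Menger space, and that $\mathbb{P}\in H(\theta)$ is a poset. Suppose further that the set of countable $M\prec H(\theta)$ such that $\mathbb{P}$ is strongly proper for $M$ is stationary in $[H(\theta)]^{\aleph_0}$. Then $\mathbb{P}$ forces that $(X,\tau)$ is Menger.
   Context: $H(\theta)$ is the collection of sets hereditarily of cardinality $<\theta$; "large enough" has its usual meaning ($\theta\ge\omega_2$ and $H(\theta)$ contains all relevant objects, such as power sets, topologies, and names built from $\mathbb{P}$ and $X$). Strong properness. Let $M\prec H(\theta)$ be countable with $\mathbb{P}\in M$. For $q\in\mathbb{P}$, a condition $\bar q\in M\cap\mathbb{P}$ is a residue of $q$ to $M$ if every $s\le\bar q$ with $s\in M$ is compatible with $q$. A condition $p\in\mathbb{P}$ is $(M,\mathbb{P})$-strongly generic if every $q\le p$ has a residue to $M$. $\mathbb{P}$ is strongly proper for $M$ if every $s\in M\cap\mathbb{P}$ can be extended to an $(M,\mathbb{P})$-strongly generic condition. Preservation. If $G$ is $V$-generic over $\mathbb{P}$, then $\tau^G$ denotes the topology on $X$ in $V[G]$ having $\tau$ as a basis. "$\mathbb{P}$ forces that $(X,\tau)$ has property $\Phi$" means that every condition forces that $(X,\tau^{\dot G})$ has property $\Phi$. A space $X$ is Menger if for every sequence $\langle\mathcal{U}_n:n\in\omega\rangle$ of open covers of $X$ there are finite subsets $\mathcal{F}_n\subseteq\mathcal{U}_n$ such that $X=\bigcup_n\bigcup\mathcal{F}_n$. *)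

theory Defs
  imports "HOL-Analysis.Abstract_Topology"
begin

unbundle cardinal_syntax

section \<open>The set-theoretic universe\<close>

text \<open>
  The universe of sets is a type whose membership relation satisfies the axioms of ZFC.
  Separation and replacement range over arbitrary HOL predicates and functions, and choice
  is the choice principle of HOL.  Hence HOL-level notions
  (countability, cardinality, finiteness, sequences indexed by \<^typ>\<open>nat\<close>) applied to
  \<open>elts x\<close> agree with those notions evaluated inside the universe.
\<close>

class zfc =
  fixes elts :: "'a \<Rightarrow> 'a set"
  assumes extensionality: "elts x = elts y \<Longrightarrow> x = y"
    and foundation: "A \<noteq> {} \<Longrightarrow> \<exists>x\<in>A. elts x \<inter> A = {}"
    and pairing: "\<exists>z. elts z = {x, y}"
    and unions: "\<exists>y. elts y = (\<Union>z\<in>elts x. elts z)"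
    and powersets: "\<exists>y. elts y = {z. elts z \<subseteq> elts x}"
    and infinity: "\<exists>x. (\<exists>e\<in>elts x. elts e = {}) \<and>
                       (\<forall>n\<in>elts x. \<exists>m\<in>elts x. elts m = insert n (elts n))"
    and separation: "\<exists>y. elts y = {z \<in> elts x. Q z}"
    and replacement: "\<exists>y. elts y = f ` elts x"

definition small :: "'v::zfc set \<Rightarrow> bool"
  where "small A \<longleftrightarrow> (\<exists>x. elts x = A)"

definition set_of :: "'v::zfc set \<Rightarrow> 'v"
  where "set_of A = (THE x. elts x = A)"

definition pair :: "'v::zfc \<Rightarrow> 'v \<Rightarrow> 'v"
  where "pair x y = set_of {set_of {x}, set_of {x, y}}"

definition VPow :: "'v::zfc \<Rightarrow> 'v"
  where "VPow x = set_of {z. elts z \<subseteq> elts x}"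

definition mem_rel :: "('v::zfc \<times> 'v) set"
  where "mem_rel = {(y, x). y \<in> elts x}"

lemma elts_set_of: "small A \<Longrightarrow> elts (set_of A) = A"
  unfolding small_def set_of_def
  by (rule theI') (auto intro: extensionality)

lemma small_elts [simp]: "small (elts x)"
  by (auto simp: small_def)

lemma small_subset: assumes "small A" "B \<subseteq> A" shows "small B"
proof -
  obtain x where x: "elts x = A" using assms by (auto simp: small_def)
  obtain y where "elts y = {z \<in> elts x. z \<in> B}"
    using separation[of x "\<lambda>z. z \<in> B"] by auto
  with x assms have "elts y = B" by auto
  then show ?thesis by (auto simp: small_def)
qed

lemma small_image:
  fixes f :: "'v::zfc \<Rightarrow> 'v"
  assumes "small A" shows "small (f ` A)"
proof -
  obtain x where "elts x = A" using assms by (auto simp: small_def)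
  then show ?thesis using replacement[of f x] by (simp add: small_def)
qed

lemma small_upair [simp]: "small {x, y}"
  unfolding small_def by (rule pairing)

lemma small_single [simp]: "small {x}"
  using small_upair[of x x] by simp

lemma small_UN:
  fixes A :: "'v::zfc set" and B :: "'v \<Rightarrow> 'v set"
  assumes "small A" "\<And>x. x \<in> A \<Longrightarrow> small (B x)" shows "small (\<Union>x\<in>A. B x)"
proof -
  have "small ((\<lambda>x. set_of (B x)) ` A)" using assms(1) by (rule small_image)
  then obtain z where z: "elts z = (\<lambda>x. set_of (B x)) ` A" by (auto simp: small_def)
  obtain y where "elts y = (\<Union>u\<in>elts z. elts u)" using unions[of z] by auto
  with z assms have "elts y = (\<Union>x\<in>A. B x)" by (auto simp: elts_set_of)
  then show ?thesis by (auto simp: small_def)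
qed

lemma small_Un: "small A \<Longrightarrow> small B \<Longrightarrow> small (A \<union> B)"
proof -
  assume A: "small A" "small B"
  have "small (\<Union>x\<in>{set_of A, set_of B}. elts x)" by (intro small_UN) auto
  with A show ?thesis by (simp add: elts_set_of)
qed

lemma elts_VPow [simp]: "elts (VPow x) = {z. elts z \<subseteq> elts x}"
  unfolding VPow_def by (rule elts_set_of) (simp add: small_def powersets)

lemma elts_pair: "elts (pair x y) = {set_of {x}, set_of {x, y}}"
  unfolding pair_def by (simp add: elts_set_of)

lemma pair_inject [simp]: "pair a b = pair c d \<longleftrightarrow> a = c \<and> b = d"
proof
  assume "pair a b = pair c d"
  then have "elts ` elts (pair a b) = elts ` elts (pair c d)" by simp
  then have "{{a}, {a, b}} = {{c}, {c, d}}" by (simp add: elts_pair elts_set_of)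
  then show "a = c \<and> b = d" by (auto simp: doubleton_eq_iff)
qed simp

lemma wf_mem_rel: "wf mem_rel"
proof (rule wfI_min)
  fix x :: 'a and Q assume "x \<in> Q"
  then obtain z where "z \<in> Q" "elts z \<inter> Q = {}" using foundation[of Q] by auto
  then show "\<exists>z\<in>Q. \<forall>y. (y, z) \<in> mem_rel \<longrightarrow> y \<notin> Q" by (auto simp: mem_rel_def)
qed

lemma pair_mem_trancl: assumes "pair c s \<in> elts a" shows "(c, a) \<in> mem_rel\<^sup>+" "(s, a) \<in> mem_rel\<^sup>+"
proof -
  have "(c, set_of {c, s}) \<in> mem_rel" "(s, set_of {c, s}) \<in> mem_rel"
    "(set_of {c, s}, pair c s) \<in> mem_rel" "(pair c s, a) \<in> mem_rel"
    using assms by (auto simp: mem_rel_def elts_set_of elts_pair)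
  then show "(c, a) \<in> mem_rel\<^sup>+" "(s, a) \<in> mem_rel\<^sup>+"
    by (blast intro: r_into_trancl trancl_into_trancl)+
qed


section \<open>Cardinals, \<open>H(\<theta>)\<close>, stationary sets\<close>

definition von_Neumann_ordinal :: "'v::zfc \<Rightarrow> bool" where
  "von_Neumann_ordinal \<alpha> \<longleftrightarrow>
     (\<forall>\<beta>\<in>elts \<alpha>. elts \<beta> \<subseteq> elts \<alpha>) \<and> (\<forall>\<beta>\<in>elts \<alpha>. \<forall>\<gamma>\<in>elts \<beta>. elts \<gamma> \<subseteq> elts \<beta>)"

definition cardinal :: "'v::zfc \<Rightarrow> bool" where
  "cardinal \<kappa> \<longleftrightarrow> von_Neumann_ordinal \<kappa> \<and> (\<forall>\<alpha>\<in>elts \<kappa>. |elts \<alpha>| <o |elts \<kappa>| )"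

definition regular_cardinal :: "'v::zfc \<Rightarrow> bool" where
  "regular_cardinal \<kappa> \<longleftrightarrow> cardinal \<kappa> \<and> infinite (elts \<kappa>) \<and>
     (\<forall>K \<subseteq> elts \<kappa>. (\<forall>\<alpha>\<in>elts \<kappa>. \<exists>\<beta>\<in>K. \<alpha> = \<beta> \<or> \<alpha> \<in> elts \<beta>) \<longrightarrow> |K| =o |elts \<kappa>| )"

definition trcl :: "'v::zfc \<Rightarrow> 'v set" where
  "trcl x = {y. (y, x) \<in> mem_rel\<^sup>+}"

definition H :: "'v::zfc \<Rightarrow> 'v set" where
  "H \<theta> = {x. |trcl x| <o |elts \<theta>| }"

text \<open>\<open>ctbl_subsets A\<close> is \<open>[A]\<^sup>\<aleph>\<^sup>0\<close>, whose members are countably infinite.\<close>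

definition ctbl_subsets :: "'a set \<Rightarrow> 'a set set" where
  "ctbl_subsets A = {M. M \<subseteq> A \<and> countable M \<and> infinite M}"

definition club_in :: "'a set \<Rightarrow> 'a set set \<Rightarrow> bool" where
  "club_in A C \<longleftrightarrow> C \<subseteq> ctbl_subsets A \<and>
     (\<forall>x\<in>ctbl_subsets A. \<exists>M\<in>C. x \<subseteq> M) \<and>
     (\<forall>f :: nat \<Rightarrow> 'a set. incseq f \<and> range f \<subseteq> C \<longrightarrow> (\<Union>n. f n) \<in> C)"

definition stationary_in :: "'a set \<Rightarrow> 'a set set \<Rightarrow> bool" where
  "stationary_in A S \<longleftrightarrow> S \<subseteq> ctbl_subsets A \<and> (\<forall>C. club_in A C \<longrightarrow> S \<inter> C \<noteq> {})"


section \<open>First-order formulas of set theory and elementary submodels\<close>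

text \<open>Variables are named by natural numbers; \<open>Ex x \<phi>\<close> binds \<open>x\<close> in \<open>\<phi>\<close>.\<close>

datatype fm = Mem nat nat | Eq nat nat | Neg fm | And fm fm | Ex nat fm

primrec sat :: "'v::zfc set \<Rightarrow> (nat \<Rightarrow> 'v) \<Rightarrow> fm \<Rightarrow> bool" where
  "sat A v (Mem x y) \<longleftrightarrow> v x \<in> elts (v y)"
| "sat A v (Eq x y) \<longleftrightarrow> v x = v y"
| "sat A v (Neg \<phi>) \<longleftrightarrow> \<not> sat A v \<phi>"
| "sat A v (And \<phi> \<psi>) \<longleftrightarrow> sat A v \<phi> \<and> sat A v \<psi>"
| "sat A v (Ex x \<phi>) \<longleftrightarrow> (\<exists>a\<in>A. sat A (v(x := a)) \<phi>)"

definition elem_submodel :: "'v::zfc set \<Rightarrow> 'v set \<Rightarrow> bool" where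
  "elem_submodel M N \<longleftrightarrow> M \<noteq> {} \<and> M \<subseteq> N \<and>
     (\<forall>\<phi> v. range v \<subseteq> M \<longrightarrow> (sat M v \<phi> \<longleftrightarrow> sat N v \<phi>))"

abbreviation "Or \<phi> \<psi> \<equiv> Neg (And (Neg \<phi>) (Neg \<psi>))"
abbreviation "Imp \<phi> \<psi> \<equiv> Neg (And \<phi> (Neg \<psi>))"
abbreviation "Iff \<phi> \<psi> \<equiv> And (Imp \<phi> \<psi>) (Imp \<psi> \<phi>)"
abbreviation "Forall x \<phi> \<equiv> Neg (Ex x (Neg \<phi>))"
abbreviation "BEx x y \<phi> \<equiv> Ex x (And (Mem x y) \<phi>)"
abbreviation "BAll x y \<phi> \<equiv> Forall x (Imp (Mem x y) \<phi>)"


section \<open>Posets, strong properness\<close>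

definition leq :: "'v::zfc \<Rightarrow> 'v \<Rightarrow> 'v \<Rightarrow> bool" where
  "leq le p q \<longleftrightarrow> pair p q \<in> elts le"

text \<open>The poset is the ordered pair \<open>pair P le\<close> of its underlying set and its order relation.\<close>

definition poset :: "'v::zfc \<Rightarrow> 'v \<Rightarrow> bool" where
  "poset P le \<longleftrightarrow> (\<forall>z\<in>elts le. \<exists>p\<in>elts P. \<exists>q\<in>elts P. z = pair p q) \<and>
     partial_order_on (elts P) {(p, q). leq le p q}"

definition compatible :: "'v::zfc \<Rightarrow> 'v \<Rightarrow> 'v \<Rightarrow> 'v \<Rightarrow> bool" where
  "compatible P le p q \<longleftrightarrow> (\<exists>r\<in>elts P. leq le r p \<and> leq le r q)"

definition residue :: "'v::zfc \<Rightarrow> 'v \<Rightarrow> 'v set \<Rightarrow> 'v \<Rightarrow> 'v \<Rightarrow> bool" where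
  "residue P le M q r \<longleftrightarrow> r \<in> M \<inter> elts P \<and>
     (\<forall>s \<in> M \<inter> elts P. leq le s r \<longrightarrow> compatible P le s q)"

definition strongly_generic :: "'v::zfc \<Rightarrow> 'v \<Rightarrow> 'v set \<Rightarrow> 'v \<Rightarrow> bool" where
  "strongly_generic P le M p \<longleftrightarrow> p \<in> elts P \<and>
     (\<forall>q\<in>elts P. leq le q p \<longrightarrow> (\<exists>r. residue P le M q r))"

definition strongly_proper_for :: "'v::zfc \<Rightarrow> 'v \<Rightarrow> 'v set \<Rightarrow> bool" where
  "strongly_proper_for P le M \<longleftrightarrow>
     (\<forall>s \<in> M \<inter> elts P. \<exists>p. leq le p s \<and> strongly_generic P le M p)"


section \<open>Forcing\<close>

inductive is_name :: "'v::zfc \<Rightarrow> 'v \<Rightarrow> bool" for P where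
  "(\<And>z. z \<in> elts a \<Longrightarrow> \<exists>c p. z = pair c p \<and> p \<in> elts P \<and> is_name P c) \<Longrightarrow> is_name P a"

text \<open>The canonical name of a ground-model set.  The poset is not assumed to have a largest
  element, so every element is paired with every condition.\<close>

function check :: "'v::zfc \<Rightarrow> 'v \<Rightarrow> 'v" where
  "check P x = set_of (\<Union>y\<in>elts x. (\<lambda>p. pair (check P y) p) ` elts P)"
  by pat_completeness auto
termination
  by (relation "inv_image mem_rel snd") (auto simp: wf_mem_rel, simp add: mem_rel_def)

declare check.simps [simp del]

definition dense_below :: "'v::zfc \<Rightarrow> 'v \<Rightarrow> 'v \<Rightarrow> ('v \<Rightarrow> bool) \<Rightarrow> bool" where
  "dense_below P le p D \<longleftrightarrow>
     (\<forall>q\<in>elts P. leq le q p \<longrightarrow> (\<exists>r\<in>elts P. leq le r q \<and> D r))"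

declare conj_cong [fundef_cong]

text \<open>The forcing relation, defined in the ground model by recursion on names for atomic formulas
  (Shoenfield, Kunen), and then by recursion on formulas.\<close>

function forces_eq :: "'v::zfc \<Rightarrow> 'v \<Rightarrow> 'v \<Rightarrow> 'v \<Rightarrow> 'v \<Rightarrow> bool" where
  "forces_eq P le p a b \<longleftrightarrow>
     (\<forall>c s. pair c s \<in> elts a \<longrightarrow>
        dense_below P le p (\<lambda>q. leq le q s \<longrightarrow>
          (\<exists>d t. pair d t \<in> elts b \<and> leq le q t \<and> forces_eq P le q c d))) \<and>
     (\<forall>d t. pair d t \<in> elts b \<longrightarrow>
        dense_below P le p (\<lambda>q. leq le q t \<longrightarrow>
          (\<exists>c s. pair c s \<in> elts a \<and> leq le q s \<and> forces_eq P le q c d)))"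
  by pat_completeness auto
termination
  by (relation "inv_image (mem_rel\<^sup>+) (\<lambda>(P, le, p, a, b). a)")
     (auto simp: wf_mem_rel wf_trancl pair_mem_trancl)

declare conj_cong [fundef_cong del]
declare forces_eq.simps [simp del]

definition forces_mem :: "'v::zfc \<Rightarrow> 'v \<Rightarrow> 'v \<Rightarrow> 'v \<Rightarrow> 'v \<Rightarrow> bool" where
  "forces_mem P le p a b \<longleftrightarrow>
     dense_below P le p (\<lambda>q. \<exists>d t. pair d t \<in> elts b \<and> leq le q t \<and> forces_eq P le q a d)"

primrec forces :: "'v::zfc \<Rightarrow> 'v \<Rightarrow> 'v \<Rightarrow> (nat \<Rightarrow> 'v) \<Rightarrow> fm \<Rightarrow> bool" where
  "forces P le p v (Mem x y) \<longleftrightarrow> forces_mem P le p (v x) (v y)"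
| "forces P le p v (Eq x y) \<longleftrightarrow> forces_eq P le p (v x) (v y)"
| "forces P le p v (Neg \<phi>) \<longleftrightarrow> (\<forall>q\<in>elts P. leq le q p \<longrightarrow> \<not> forces P le q v \<phi>)"
| "forces P le p v (And \<phi> \<psi>) \<longleftrightarrow> forces P le p v \<phi> \<and> forces P le p v \<psi>"
| "forces P le p v (Ex x \<phi>) \<longleftrightarrow>
     dense_below P le p (\<lambda>q. \<exists>a. is_name P a \<and> forces P le q (v(x := a)) \<phi>)"


section \<open>Menger spaces\<close>

definition Menger_space :: "'a topology \<Rightarrow> bool" where
  "Menger_space T \<longleftrightarrow>
     (\<forall>U :: nat \<Rightarrow> 'a set set. (\<forall>n. (\<forall>S\<in>U n. openin T S) \<and> \<Union>(U n) = topspace T) \<longrightarrow>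
        (\<exists>F. (\<forall>n. finite (F n) \<and> F n \<subseteq> U n) \<and> (\<Union>n. \<Union>(F n)) = topspace T))"

definition open_sets :: "'v::zfc \<Rightarrow> 'v set \<Rightarrow> bool" where
  "open_sets \<tau> S \<longleftrightarrow> S \<in> elts ` elts \<tau>"

definition is_top_space :: "'v::zfc \<Rightarrow> 'v \<Rightarrow> bool" where
  "is_top_space X \<tau> \<longleftrightarrow> istopology (open_sets \<tau>) \<and> (\<Union>U\<in>elts \<tau>. elts U) = elts X"

definition space_of :: "'v::zfc \<Rightarrow> 'v topology" where
  "space_of \<tau> = topology (open_sets \<tau>)"

subsection \<open>The Menger property as a formula of set theory\<close>

text \<open>Bound variables are chosen larger than all variables passed as arguments, so that no
  capture occurs.\<close>

text \<open>\<open>x \<subseteq> y\<close>\<close>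
definition fm_sub :: "nat \<Rightarrow> nat \<Rightarrow> fm" where
  "fm_sub x y = (let z = x + y + 1 in Forall z (Imp (Mem z x) (Mem z y)))"

text \<open>\<open>x = \<Union>u\<close>\<close>
definition fm_Union :: "nat \<Rightarrow> nat \<Rightarrow> fm" where
  "fm_Union x u = (let z = x + u + 1; y = x + u + 2 in
     Forall z (Iff (Mem z x) (BEx y u (Mem z y))))"

text \<open>\<open>x = {}\<close>\<close>
definition fm_empty :: "nat \<Rightarrow> fm" where
  "fm_empty x = (let z = x + 1 in Forall z (Neg (Mem z x)))"

text \<open>\<open>y = x \<union> {x}\<close>\<close>
definition fm_succ :: "nat \<Rightarrow> nat \<Rightarrow> fm" where
  "fm_succ y x = (let z = x + y + 1 in Forall z (Iff (Mem z y) (Or (Mem z x) (Eq z x))))"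

text \<open>\<open>w\<close> contains \<open>{}\<close> and is closed under successors\<close>
definition fm_inductive :: "nat \<Rightarrow> fm" where
  "fm_inductive w = (let n = w + 1; m = w + 2 in
     And (BEx n w (fm_empty n)) (BAll n w (BEx m w (fm_succ m n))))"

text \<open>\<open>w = \<omega>\<close>, the least inductive set\<close>
definition fm_omega :: "nat \<Rightarrow> fm" where
  "fm_omega w = (let z = w + 1 in
     And (fm_inductive w) (Forall z (Imp (fm_inductive z) (fm_sub w z))))"

text \<open>\<open>z = {x, y}\<close>\<close>
definition fm_upair :: "nat \<Rightarrow> nat \<Rightarrow> nat \<Rightarrow> fm" where
  "fm_upair z x y = (let u = x + y + z + 1 in Forall u (Iff (Mem u z) (Or (Eq u x) (Eq u y))))"

text \<open>\<open>z = \<langle>x, y\<rangle>\<close>\<close>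
definition fm_pair :: "nat \<Rightarrow> nat \<Rightarrow> nat \<Rightarrow> fm" where
  "fm_pair z x y = (let a = x + y + z + 1; b = x + y + z + 2 in
     Ex a (Ex b (And (fm_upair a x x) (And (fm_upair b x y) (fm_upair z a b)))))"

text \<open>\<open>\<langle>x, y\<rangle> \<in> f\<close>, that is, \<open>f(x) = y\<close> for a function \<open>f\<close>\<close>
definition fm_app :: "nat \<Rightarrow> nat \<Rightarrow> nat \<Rightarrow> fm" where
  "fm_app f x y = (let z = f + x + y + 1 in BEx z f (fm_pair z x y))"

text \<open>\<open>f\<close> is a function with domain \<open>d\<close>\<close>
definition fm_fun :: "nat \<Rightarrow> nat \<Rightarrow> fm" where
  "fm_fun f d = (let z = f + d + 1; x = f + d + 2; y = f + d + 3; y' = f + d + 4 in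
     And (BAll z f (BEx x d (Ex y (fm_pair z x y))))
         (BAll x d (Ex y (And (fm_app f x y) (Forall y' (Imp (fm_app f x y') (Eq y' y)))))))"

text \<open>\<open>a = {g(i) | i \<in> n}\<close> for some \<open>n \<in> \<omega>\<close> and some function \<open>g\<close> with domain \<open>n\<close>\<close>
definition fm_finite :: "nat \<Rightarrow> fm" where
  "fm_finite a = (let w = a + 1; n = a + 2; g = a + 3; y = a + 4; i = a + 5 in
     Ex w (And (fm_omega w) (BEx n w (Ex g (And (fm_fun g n)
       (Forall y (Iff (Mem y a) (BEx i n (fm_app g i y)))))))))"

text \<open>for every sequence \<open>\<langle>s(n) | n \<in> w\<rangle>\<close> of covers of \<open>X\<close> by members of \<open>T\<close> there is
  \<open>\<langle>f(n) | n \<in> w\<rangle>\<close> with finite \<open>f(n) \<subseteq> s(n)\<close> such that \<open>X = \<Union>\<^sub>n \<Union>f(n)\<close>\<close>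
definition fm_selection :: "nat \<Rightarrow> nat \<Rightarrow> nat \<Rightarrow> fm" where
  "fm_selection X T w =
    (let k = X + T + w; s = k + 1; f = k + 2; n = k + 3; u = k + 4; a = k + 5; x = k + 6; U = k + 7 in
     Forall s (Imp
       (And (fm_fun s w)
            (BAll n w (Forall u (Imp (fm_app s n u) (And (fm_sub u T) (fm_Union X u))))))
       (Ex f (And (fm_fun f w) (And
          (BAll n w (Forall u (Forall a (Imp (And (fm_app s n u) (fm_app f n a))
             (And (fm_sub a u) (fm_finite a))))))
          (Forall x (Iff (Mem x X)
             (BEx n w (Ex a (And (fm_app f n a) (BEx U a (Mem x U))))))))))))"

text \<open>\<open>T\<close> is the set of all unions of subsets of \<open>b\<close>, i.e. the topology with basis \<open>b\<close>\<close>
definition fm_topology_with_basis :: "nat \<Rightarrow> nat \<Rightarrow> fm" where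
  "fm_topology_with_basis T b = (let U = T + b + 1; S = T + b + 2 in
     Forall U (Iff (Mem U T) (Ex S (And (fm_sub S b) (fm_Union U S)))))"

text \<open>\<open>X\<close> with the topology having \<open>b\<close> as a basis is Menger\<close>
definition fm_Menger :: "nat \<Rightarrow> nat \<Rightarrow> fm" where
  "fm_Menger X b = (let T = X + b + 1; w = X + b + 2 in
     Ex T (Ex w (And (fm_topology_with_basis T b) (And (fm_omega w) (fm_selection X T w)))))"

definition val2 :: "'v \<Rightarrow> 'v \<Rightarrow> nat \<Rightarrow> 'v" where
  "val2 x y i = (if i = 0 then x else y)"

definition forces_Menger :: "'v::zfc \<Rightarrow> 'v \<Rightarrow> 'v \<Rightarrow> 'v \<Rightarrow> bool" where
  "forces_Menger P le X \<tau> \<longleftrightarrow>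
     (\<forall>p\<in>elts P. forces P le p (val2 (check P X) (check P \<tau>)) (fm_Menger 0 1))"

subsection \<open>Adequacy of the formula in the ground model\<close>

lemma eq_set_of: "small A \<Longrightarrow> z = set_of A \<longleftrightarrow> elts z = A"
  by (metis elts_set_of extensionality)

lemma sat_connectives:
  "sat A v (Imp \<phi> \<psi>) \<longleftrightarrow> (sat A v \<phi> \<longrightarrow> sat A v \<psi>)"
  "sat A v (Iff \<phi> \<psi>) \<longleftrightarrow> (sat A v \<phi> \<longleftrightarrow> sat A v \<psi>)"
  "sat UNIV v (Ex x \<phi>) \<longleftrightarrow> (\<exists>a. sat UNIV (v(x := a)) \<phi>)"
  "sat UNIV v (Forall x \<phi>) \<longleftrightarrow> (\<forall>a. sat UNIV (v(x := a)) \<phi>)"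
  by auto

lemma sat_sub [simp]: "sat UNIV v (fm_sub x y) \<longleftrightarrow> elts (v x) \<subseteq> elts (v y)"
  by (auto simp: fm_sub_def Let_def)

lemma sat_Union [simp]: "sat UNIV v (fm_Union x u) \<longleftrightarrow> elts (v x) = (\<Union>y\<in>elts (v u). elts y)"
  by (auto simp: fm_Union_def Let_def)

lemma sat_empty [simp]: "sat UNIV v (fm_empty x) \<longleftrightarrow> elts (v x) = {}"
  by (auto simp: fm_empty_def Let_def)

lemma sat_succ [simp]: "sat UNIV v (fm_succ y x) \<longleftrightarrow> elts (v y) = insert (v x) (elts (v x))"
  by (auto simp: fm_succ_def Let_def)

definition is_inductive :: "'v::zfc \<Rightarrow> bool" where
  "is_inductive w \<longleftrightarrow> (\<exists>e\<in>elts w. elts e = {}) \<and>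
     (\<forall>n\<in>elts w. \<exists>m\<in>elts w. elts m = insert n (elts n))"

lemma sat_inductive [simp]: "sat UNIV v (fm_inductive w) \<longleftrightarrow> is_inductive (v w)"
  by (simp add: fm_inductive_def Let_def is_inductive_def Bex_def Ball_def)

lemma sat_upair [simp]: "sat UNIV v (fm_upair z x y) \<longleftrightarrow> elts (v z) = {v x, v y}"
  by (auto simp: fm_upair_def Let_def)

lemma sat_pair [simp]: "sat UNIV v (fm_pair z x y) \<longleftrightarrow> v z = pair (v x) (v y)"
  by (auto simp: fm_pair_def Let_def pair_def eq_set_of[symmetric])

lemma sat_app [simp]: "sat UNIV v (fm_app f x y) \<longleftrightarrow> pair (v x) (v y) \<in> elts (v f)"
  by (auto simp: fm_app_def Let_def)

definition is_fun :: "'v::zfc \<Rightarrow> 'v \<Rightarrow> bool" where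
  "is_fun f d \<longleftrightarrow> (\<forall>z\<in>elts f. \<exists>x\<in>elts d. \<exists>y. z = pair x y) \<and>
     (\<forall>x\<in>elts d. \<exists>!y. pair x y \<in> elts f)"

lemma sat_fun [simp]: "sat UNIV v (fm_fun f d) \<longleftrightarrow> is_fun (v f) (v d)"
  unfolding is_fun_def by (simp add: fm_fun_def Let_def) blast

primrec nat_of :: "nat \<Rightarrow> 'v::zfc" where
  "nat_of 0 = set_of {}"
| "nat_of (Suc n) = set_of (insert (nat_of n) (elts (nat_of n)))"

lemma small_empty [simp]: "small {}"
  using small_subset[OF small_elts] by blast

lemma small_insert [simp]: "small A \<Longrightarrow> small (insert x A)"
  using small_Un[of "{x}" A] by simp

lemma elts_nat_of_0 [simp]: "elts (nat_of 0) = {}"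
  by (simp add: elts_set_of)

lemma elts_nat_of_Suc [simp]: "elts (nat_of (Suc n)) = insert (nat_of n) (elts (nat_of n))"
  by (simp add: elts_set_of)

declare nat_of.simps [simp del]

lemma elts_nat_of: "elts (nat_of n) = nat_of ` {..<n}"
  by (induction n) (auto simp: lessThan_Suc)

lemma mem_irrefl: "x \<notin> elts x"
  using foundation[of "{x}"] by auto

lemma inj_nat_of: "inj nat_of"
proof (rule linorder_injI)
  fix m n :: nat assume "m < n"
  then have "nat_of m \<in> elts (nat_of n)" by (auto simp: elts_nat_of)
  then show "nat_of m \<noteq> nat_of n" using mem_irrefl by metis
qed

lemma nat_of_eq [simp]: "nat_of m = nat_of n \<longleftrightarrow> m = n"
  using inj_nat_of by (auto dest: injD)

lemma range_nat_of_subset: assumes "is_inductive w" shows "range nat_of \<subseteq> elts w"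
proof -
  have "nat_of n \<in> elts w" for n
  proof (induction n)
    case 0
    show ?case using assms unfolding is_inductive_def by (metis extensionality elts_nat_of_0)
  next
    case (Suc n)
    then show ?case using assms unfolding is_inductive_def
      by (metis extensionality elts_nat_of_Suc)
  qed
  then show ?thesis by auto
qed

lemma elts_omega: "elts (set_of (range nat_of)) = range nat_of"
proof (rule elts_set_of)
  obtain w :: 'a where "is_inductive w" using infinity unfolding is_inductive_def by blast
  then show "small (range (nat_of :: nat \<Rightarrow> 'a))"
    using range_nat_of_subset small_subset small_elts by metis
qed

lemma inductive_omega: "is_inductive (set_of (range nat_of))"
  unfolding is_inductive_def elts_omega using elts_nat_of_Suc elts_nat_of_0 by blast

lemma sat_omega [simp]: "sat UNIV v (fm_omega w) \<longleftrightarrow> v w = set_of (range nat_of)"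
proof -
  have "sat UNIV v (fm_omega w) \<longleftrightarrow>
      is_inductive (v w) \<and> (\<forall>z. is_inductive z \<longrightarrow> elts (v w) \<subseteq> elts z)"
    by (simp add: fm_omega_def Let_def)
  also have "\<dots> \<longleftrightarrow> v w = set_of (range nat_of)"
    using inductive_omega range_nat_of_subset elts_omega extensionality
    by (metis subset_antisym)
  finally show ?thesis .
qed

lemma ex_fun: "\<exists>f. is_fun f d \<and> (\<forall>x y. pair x y \<in> elts f \<longleftrightarrow> x \<in> elts d \<and> y = h x)"
proof -
  have "elts (set_of ((\<lambda>x. pair x (h x)) ` elts d)) = (\<lambda>x. pair x (h x)) ` elts d"
    by (intro elts_set_of small_image small_elts)
  then show ?thesis
    by (intro exI[of _ "set_of ((\<lambda>x. pair x (h x)) ` elts d)"]) (auto simp: is_fun_def)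
qed

lemma sat_finite [simp]: "sat UNIV v (fm_finite a) \<longleftrightarrow> finite (elts (v a))"
proof -
  have "sat UNIV v (fm_finite a) \<longleftrightarrow> (\<exists>k g. is_fun g (nat_of k) \<and>
      elts (v a) = {y. \<exists>i\<in>elts (nat_of k). pair i y \<in> elts g})"
    by (simp add: fm_finite_def Let_def elts_omega set_eq_iff) blast
  also have "\<dots> \<longleftrightarrow> finite (elts (v a))"
  proof
    assume "\<exists>k g. is_fun g (nat_of k) \<and>
      elts (v a) = {y. \<exists>i\<in>elts (nat_of k). pair i y \<in> elts g}"
    then obtain k g where g: "is_fun g (nat_of k)"
      "elts (v a) = {y. \<exists>i\<in>elts (nat_of k). pair i y \<in> elts g}" by blast
    then have "elts (v a) \<subseteq> (\<lambda>i. THE y. pair i y \<in> elts g) ` elts (nat_of k)"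
      unfolding is_fun_def by (auto simp: image_iff) (metis (mono_tags, lifting) the_equality)
    then show "finite (elts (v a))"
      by (rule finite_subset) (simp add: elts_nat_of)
  next
    assume "finite (elts (v a))"
    then obtain k :: nat and h where h: "elts (v a) = h ` {i. i < k}"
      using finite_imp_nat_seg_image_inj_on by metis
    obtain g where "is_fun g (nat_of k)"
      "\<And>x y. pair x y \<in> elts g \<longleftrightarrow> x \<in> elts (nat_of k) \<and> y = (h \<circ> inv nat_of) x"
      using ex_fun[of "nat_of k" "h \<circ> inv nat_of"] by auto
    moreover have "inv nat_of (nat_of i :: 'a) = i" for i
      using inj_nat_of by (rule inv_f_f)
    ultimately show "\<exists>k g. is_fun g (nat_of k) \<and>
      elts (v a) = {y. \<exists>i\<in>elts (nat_of k). pair i y \<in> elts g}"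
      using h by (intro exI[of _ k] exI[of _ g]) (auto simp: elts_nat_of)
  qed
  finally show ?thesis .
qed

lemma openin_space_of:
  assumes "is_top_space X \<tau>"
  shows "openin (space_of \<tau>) S \<longleftrightarrow> S \<in> elts ` elts \<tau>" "topspace (space_of \<tau>) = elts X"
proof -
  show *: "openin (space_of \<tau>) S \<longleftrightarrow> S \<in> elts ` elts \<tau>" for S
    using assms by (simp add: is_top_space_def space_of_def open_sets_def topology_inverse')
  have "topspace (space_of \<tau>) = \<Union>(elts ` elts \<tau>)"
    unfolding topspace_def using * by auto
  then show "topspace (space_of \<tau>) = elts X"
    using assms by (simp add: is_top_space_def)
qed

lemma ball_range: "(\<forall>a. a \<in> range f \<longrightarrow> Q a) \<longleftrightarrow> (\<forall>n. Q (f n))"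
  by auto

lemma sat_selection:
  assumes top: "is_top_space (v X) (v T)" and w: "v w = set_of (range nat_of)"
  shows "sat UNIV v (fm_selection X T w) \<longleftrightarrow> Menger_space (space_of (v T))"
proof -
  note op = openin_space_of[OF top]
  define W where "W = set_of (range (nat_of :: nat \<Rightarrow> 'a))"
  have W: "elts W = range nat_of" unfolding W_def by (rule elts_omega)
  have sat: "sat UNIV v (fm_selection X T w) \<longleftrightarrow>
    (\<forall>s. is_fun s W \<and> (\<forall>n u. pair (nat_of n) u \<in> elts s \<longrightarrow>
           elts u \<subseteq> elts (v T) \<and> elts (v X) = (\<Union>y\<in>elts u. elts y)) \<longrightarrow>
      (\<exists>f. is_fun f W \<and>
         (\<forall>n u. pair (nat_of n) u \<in> elts s \<longrightarrow>
            (\<forall>a. pair (nat_of n) a \<in> elts f \<longrightarrow> elts a \<subseteq> elts u \<and> finite (elts a))) \<and>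
         (\<forall>x. x \<in> elts (v X) \<longleftrightarrow>
            (\<exists>n a. pair (nat_of n) a \<in> elts f \<and> (\<exists>U\<in>elts a. x \<in> elts U)))))"
    by (simp add: fm_selection_def Let_def sat_connectives w W_def[symmetric] W Bex_def
        ball_range imp_conjL iff_conv_conj_imp[where Q = "\<exists>n. R n" for R] del: sat.simps(3))
  show ?thesis unfolding sat
  proof (intro iffI allI impI; (elim conjE)?)
    assume L: "\<forall>s. is_fun s W \<and> (\<forall>n u. pair (nat_of n) u \<in> elts s \<longrightarrow>
           elts u \<subseteq> elts (v T) \<and> elts (v X) = (\<Union>y\<in>elts u. elts y)) \<longrightarrow>
      (\<exists>f. is_fun f W \<and>
         (\<forall>n u. pair (nat_of n) u \<in> elts s \<longrightarrow>
            (\<forall>a. pair (nat_of n) a \<in> elts f \<longrightarrow> elts a \<subseteq> elts u \<and> finite (elts a))) \<and>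
         (\<forall>x. x \<in> elts (v X) \<longleftrightarrow>
            (\<exists>n a. pair (nat_of n) a \<in> elts f \<and> (\<exists>U\<in>elts a. x \<in> elts U))))"
    show "Menger_space (space_of (v T))"
      unfolding Menger_space_def op
    proof (intro allI impI)
      fix U :: "nat \<Rightarrow> 'a set set"
      assume U: "\<forall>n. (\<forall>S\<in>U n. S \<in> elts ` elts (v T)) \<and> \<Union>(U n) = elts (v X)"
      define h where "h n = set_of {u \<in> elts (v T). elts u \<in> U n}" for n
      have h: "elts (h n) = {u \<in> elts (v T). elts u \<in> U n}" for n
        unfolding h_def by (rule elts_set_of) (auto intro: small_subset[OF small_elts])
      obtain s where s: "is_fun s W"
        "\<And>x y. pair x y \<in> elts s \<longleftrightarrow> x \<in> elts W \<and> y = (h \<circ> inv nat_of) x"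
        using ex_fun[of W "h \<circ> inv nat_of"] by auto
      have s': "pair (nat_of n) y \<in> elts s \<longleftrightarrow> y = h n" for n y
        using s(2) by (simp add: W inv_f_f[OF inj_nat_of])
      have "U n \<subseteq> elts ` elts (v T)" for n
        using U by blast
      then have Uh: "U n = elts ` elts (h n)" for n
        unfolding h by (fastforce simp: image_iff)
      have "elts (h n) \<subseteq> elts (v T) \<and> elts (v X) = (\<Union>y\<in>elts (h n). elts y)" for n
      proof
        show "elts (h n) \<subseteq> elts (v T)" unfolding h by blast
        have "\<Union>(U n) = elts (v X)" using U by blast
        then show "elts (v X) = (\<Union>y\<in>elts (h n). elts y)" unfolding Uh by (rule sym)
      qed
      then have "\<exists>f. is_fun f W \<and>
         (\<forall>n u. pair (nat_of n) u \<in> elts s \<longrightarrow>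
            (\<forall>a. pair (nat_of n) a \<in> elts f \<longrightarrow> elts a \<subseteq> elts u \<and> finite (elts a))) \<and>
         (\<forall>x. x \<in> elts (v X) \<longleftrightarrow>
            (\<exists>n a. pair (nat_of n) a \<in> elts f \<and> (\<exists>U\<in>elts a. x \<in> elts U)))"
        using s(1) by (intro L[THEN spec, THEN mp]) (simp add: s')
      then obtain f where f: "is_fun f W"
         "\<And>n a. pair (nat_of n) a \<in> elts f \<Longrightarrow> elts a \<subseteq> elts (h n) \<and> finite (elts a)"
         "\<And>x. x \<in> elts (v X) \<longleftrightarrow>
            (\<exists>n a. pair (nat_of n) a \<in> elts f \<and> (\<exists>U\<in>elts a. x \<in> elts U))"
        unfolding s' by auto
      define F where "F n = elts ` elts (THE a. pair (nat_of n) a \<in> elts f)" for n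
      have F: "F n = elts ` elts a" if "pair (nat_of n) a \<in> elts f" for n a
    proof -
        have "\<exists>!a. pair (nat_of n) a \<in> elts f"
          using f(1) unfolding is_fun_def W by simp
        then have "(THE a. pair (nat_of n) a \<in> elts f) = a" using that by (rule the1_equality)
        then show ?thesis by (simp add: F_def)
      qed
      have ex: "\<exists>a. pair (nat_of n) a \<in> elts f" for n
        using f(1) unfolding is_fun_def W by blast
      show "\<exists>F. (\<forall>n. finite (F n) \<and> F n \<subseteq> U n) \<and> (\<Union>n. \<Union>(F n)) = elts (v X)"
      proof (intro exI[of _ F] conjI allI)
        fix n
        obtain a where "pair (nat_of n) a \<in> elts f" using ex by blast
        with f(2) F Uh show "finite (F n)" "F n \<subseteq> U n" by auto
      next
        show "(\<Union>n. \<Union>(F n)) = elts (v X)"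
        proof (intro set_eqI)
          fix x
          have "x \<in> elts (v X) \<longleftrightarrow> (\<exists>n a. pair (nat_of n) a \<in> elts f \<and> x \<in> \<Union>(F n))"
            unfolding f(3) by (intro ex_cong1 conj_cong refl) (simp add: F)
          then show "x \<in> (\<Union>n. \<Union>(F n)) \<longleftrightarrow> x \<in> elts (v X)"
            using ex by blast
        qed
      qed
    qed
  next
    fix s
    assume M: "Menger_space (space_of (v T))" and s: "is_fun s W"
      and cov: "\<forall>n u. pair (nat_of n) u \<in> elts s \<longrightarrow>
           elts u \<subseteq> elts (v T) \<and> elts (v X) = (\<Union>y\<in>elts u. elts y)"
    have "\<exists>u. pair (nat_of n) u \<in> elts s" for n
      using s unfolding is_fun_def W by blast
    then obtain h where h: "\<And>n. pair (nat_of n) (h n) \<in> elts s" by metis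
    have hs: "pair (nat_of n) u \<in> elts s \<longleftrightarrow> u = h n" for n u
    proof -
      have "\<exists>!u. pair (nat_of n) u \<in> elts s"
        using s unfolding is_fun_def W by simp
      then show ?thesis using h[of n] by blast
    qed
    have "\<forall>n. (\<forall>S\<in>elts ` elts (h n). S \<in> elts ` elts (v T)) \<and> \<Union>(elts ` elts (h n)) = elts (v X)"
      using cov h by blast
    then obtain F where F: "\<And>n. finite (F n) \<and> F n \<subseteq> elts ` elts (h n)"
        "(\<Union>n. \<Union>(F n)) = elts (v X)"
      using M[unfolded Menger_space_def op, rule_format, of "\<lambda>n. elts ` elts (h n)"] by auto
    define k where "k n = set_of {u \<in> elts (h n). elts u \<in> F n}" for n
    have k: "elts (k n) = {u \<in> elts (h n). elts u \<in> F n}" for n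
      unfolding k_def by (rule elts_set_of) (auto intro: small_subset[OF small_elts])
    have Fk: "F n = elts ` elts (k n)" for n
      using F(1)[of n] by (auto simp: k)
    have fin: "finite (elts (k n))" for n
      using F(1)[of n] unfolding Fk
      by (auto dest!: finite_imageD intro: inj_onI extensionality)
    obtain f where f: "is_fun f W"
        "\<And>x y. pair x y \<in> elts f \<longleftrightarrow> x \<in> elts W \<and> y = (k \<circ> inv nat_of) x"
        using ex_fun[of W "k \<circ> inv nat_of"] by auto
    have f': "pair (nat_of n) y \<in> elts f \<longleftrightarrow> y = k n" for n y
      using f(2) by (simp add: W inv_f_f[OF inj_nat_of])
    have "x \<in> elts (v X) \<longleftrightarrow> (\<exists>n. \<exists>U\<in>elts (k n). x \<in> elts U)" for x
      unfolding F(2)[symmetric] Fk by auto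
    then show "\<exists>f. is_fun f W \<and>
         (\<forall>n u. pair (nat_of n) u \<in> elts s \<longrightarrow>
            (\<forall>a. pair (nat_of n) a \<in> elts f \<longrightarrow> elts a \<subseteq> elts u \<and> finite (elts a))) \<and>
         (\<forall>x. x \<in> elts (v X) \<longleftrightarrow>
            (\<exists>n a. pair (nat_of n) a \<in> elts f \<and> (\<exists>U\<in>elts a. x \<in> elts U)))"
      using f(1) fin by (intro exI[of _ f]) (auto simp: f' hs k)
  qed
qed

lemma sat_topology_with_basis: "sat UNIV v (fm_topology_with_basis T b) \<longleftrightarrow>
    (\<forall>U. U \<in> elts (v T) \<longleftrightarrow> (\<exists>S. elts S \<subseteq> elts (v b) \<and> elts U = (\<Union>z\<in>elts S. elts z)))"
  by (simp add: fm_topology_with_basis_def Let_def sat_connectives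
      iff_conv_conj_imp[where Q = "\<exists>n. R n" for R] del: sat.simps(3))

theorem sat_Menger_iff:
  assumes "is_top_space X \<tau>"
  shows "sat UNIV (val2 X \<tau>) (fm_Menger 0 1) \<longleftrightarrow> Menger_space (space_of \<tau>)"
proof -
  have un: "\<exists>y\<in>elts \<tau>. elts y = (\<Union>z\<in>elts S. elts z)" if "elts S \<subseteq> elts \<tau>" for S
  proof -
    have "\<forall>K\<in>elts ` elts S. open_sets \<tau> K" using that by (auto simp: open_sets_def)
    then have "open_sets \<tau> (\<Union>(elts ` elts S))"
      using assms unfolding is_top_space_def istopology_def by blast
    then show ?thesis by (auto simp: open_sets_def image_iff)
  qed
  have basis: "(\<forall>U. U \<in> elts T \<longleftrightarrow> (\<exists>S. elts S \<subseteq> elts \<tau> \<and> elts U = (\<Union>z\<in>elts S. elts z))) \<longleftrightarrow> T = \<tau>"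
    for T
  proof -
    have "(\<exists>S. elts S \<subseteq> elts \<tau> \<and> elts U = (\<Union>z\<in>elts S. elts z)) \<longleftrightarrow> U \<in> elts \<tau>" for U
    proof
      show "\<exists>S. elts S \<subseteq> elts \<tau> \<and> elts U = (\<Union>z\<in>elts S. elts z) \<Longrightarrow> U \<in> elts \<tau>"
        using un extensionality by metis
      show "U \<in> elts \<tau> \<Longrightarrow> \<exists>S. elts S \<subseteq> elts \<tau> \<and> elts U = (\<Union>z\<in>elts S. elts z)"
        by (intro exI[of _ "set_of {U}"]) (simp add: elts_set_of)
    qed
    then show ?thesis using extensionality by (metis subsetI subset_antisym)
  qed
  show ?thesis
    using assms
    by (simp add: fm_Menger_def Let_def sat_topology_with_basis basis sat_selection val2_def
        cong: conj_cong)
qed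

text \<open>A lower bound for \<open>\<theta>\<close>: \<open>\<theta> \<ge> \<omega>\<^sub>2\<close>, and \<open>H(\<theta>)\<close> contains the power set of \<open>P\<close>, the set
  of all families of subsets of \<open>X\<close> (among them the topologies on \<open>X\<close>), and the set
  \<open>VPow (check P (VPow X))\<close> of canonical names for families of ground-model subsets of \<open>X\<close>.
  Any stronger requirement on \<open>\<theta>\<close> yields a weaker theorem.\<close>

definition large_enough :: "'v::zfc \<Rightarrow> 'v \<Rightarrow> 'v \<Rightarrow> bool" where
  "large_enough \<theta> P X \<longleftrightarrow> cardSuc (cardSuc natLeq) \<le>o |elts \<theta>| \<and>
     VPow P \<in> H \<theta> \<and> VPow (VPow X) \<in> H \<theta> \<and> VPow (check P (VPow X)) \<in> H \<theta>"

end

(* The forcing relation is analysed in Kripke style: a formula is forced iff it is forced densely,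
   so quantifiers and connectives unfold to statements about all conditions below a given one, and
   each formula of the Menger property reduces to a statement about names.

   Suppose p forces s to be a sequence of open covers.  For a condition r compatible with p and n < omega,
   the ground-model open sets that some t \<le> r, p forces to lie inside a member of s(n) cover X; the
   Menger property of X yields a countable subcover with witnesses t.  Take a countable M closed under
   r |-> witnesses for which P is strongly proper, let p1 \<le> p be strongly generic for M, and enumerate
   the conditions in M as r_m.  For each m, the Menger property applied to the subcovers for r_m and n \<ge> m
   selects finitely many witnesses for each n.  In the extension pick from s(n) those members selected for
   some m \<le> n whose witness lies in the generic filter.  These finite sets cover X: given x and q \<le> p1,
   let r_m be a residue of q to M; some witness t \<le> r_m in M covers x, and t is compatible with q.
   Closure under the witness map replaces elementarity of M: the closed sets form a club. *)

theory Submission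
  imports Defs
begin

section \<open>The forcing relation\<close>

locale forcing_poset =
  fixes P le :: "'v::zfc"
  assumes poset: "poset P le"
begin

abbreviation below :: "'v \<Rightarrow> 'v \<Rightarrow> bool" (infix "\<preceq>" 50) where
  "q \<preceq> p \<equiv> leq le q p"

abbreviation dense :: "'v \<Rightarrow> ('v \<Rightarrow> bool) \<Rightarrow> bool" where
  "dense \<equiv> dense_below P le"

abbreviation feq :: "'v \<Rightarrow> 'v \<Rightarrow> 'v \<Rightarrow> bool" where
  "feq \<equiv> forces_eq P le"

abbreviation fmem :: "'v \<Rightarrow> 'v \<Rightarrow> 'v \<Rightarrow> bool" where
  "fmem \<equiv> forces_mem P le"

abbreviation name :: "'v \<Rightarrow> bool" where
  "name \<equiv> is_name P"

lemma below_carrier: assumes "q \<preceq> p" shows "q \<in> elts P" "p \<in> elts P"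
  using poset assms unfolding poset_def leq_def by fastforce+

lemma below_refl: "p \<in> elts P \<Longrightarrow> p \<preceq> p"
  using poset unfolding poset_def partial_order_on_def preorder_on_def refl_on_def by auto

lemma below_refl': "q \<preceq> p \<Longrightarrow> q \<preceq> q"
  using below_carrier below_refl by blast

lemma below_trans: "r \<preceq> q \<Longrightarrow> q \<preceq> p \<Longrightarrow> r \<preceq> p"
  using poset unfolding poset_def partial_order_on_def preorder_on_def trans_def by blast

section \<open>Density below a condition\<close>

lemma dense_iff: "dense p D \<longleftrightarrow> (\<forall>q. q \<preceq> p \<longrightarrow> (\<exists>r. r \<preceq> q \<and> D r))"
  unfolding dense_below_def using below_carrier by blast

lemma denseI: "(\<And>q. q \<preceq> p \<Longrightarrow> \<exists>r. r \<preceq> q \<and> D r) \<Longrightarrow> dense p D"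
  by (simp add: dense_iff)

lemma denseE:
  assumes "dense p D" "q \<preceq> p"
  obtains r where "r \<preceq> q" "D r"
  using assms by (auto simp: dense_iff)

lemma dense_mono: "dense p D \<Longrightarrow> q \<preceq> p \<Longrightarrow> dense q D"
  unfolding dense_iff using below_trans by blast

lemma dense_weaken: "dense p D \<Longrightarrow> (\<And>q. q \<preceq> p \<Longrightarrow> D q \<Longrightarrow> E q) \<Longrightarrow> dense p E"
  unfolding dense_iff using below_trans by meson

lemma dense_cong:
  "(\<And>q. q \<preceq> p \<Longrightarrow> D q \<longleftrightarrow> E q) \<Longrightarrow> dense p D \<longleftrightarrow> dense p E"
  by (rule iffI; erule dense_weaken; simp)

lemma dense_all: "(\<And>q. q \<preceq> p \<Longrightarrow> D q) \<Longrightarrow> dense p D"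
  unfolding dense_iff using below_refl' by blast

lemma dense_dense: "dense p (\<lambda>q. dense q D) \<longleftrightarrow> dense p D"
  unfolding dense_iff using below_trans below_refl' by meson

section \<open>Regular properties of conditions\<close>

text \<open>No condition lies below an element outside \<open>P\<close>; such elements force everything, so
  regularity needs no restriction to \<open>P\<close>.\<close>

definition regular :: "('v \<Rightarrow> bool) \<Rightarrow> bool" where
  "regular D \<longleftrightarrow> (\<forall>p. D p \<longleftrightarrow> dense p D)"

lemma regular_dense: "regular (\<lambda>p. dense p D)"
  by (simp add: regular_def dense_dense)

lemma regular_mono: "regular D \<Longrightarrow> D p \<Longrightarrow> q \<preceq> p \<Longrightarrow> D q"
  unfolding regular_def using dense_mono by metis

lemma regularI: assumes "regular D" "\<And>q. q \<preceq> p \<Longrightarrow> \<exists>r. r \<preceq> q \<and> D r" shows "D p"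
  using assms denseI unfolding regular_def by metis

lemma regularI':
  assumes "\<And>p q. D p \<Longrightarrow> q \<preceq> p \<Longrightarrow> D q"
    and "\<And>p. (\<And>q. q \<preceq> p \<Longrightarrow> \<exists>r. r \<preceq> q \<and> D r) \<Longrightarrow> D p"
  shows "regular D"
  unfolding regular_def dense_iff using assms below_refl' by metis

lemma regular_dense_use:
  assumes "regular E" "dense p D" "\<And>q. q \<preceq> p \<Longrightarrow> D q \<Longrightarrow> E q" shows "E p"
  using assms dense_weaken unfolding regular_def by metis

lemma regular_all: "(\<And>x. regular (D x)) \<Longrightarrow> regular (\<lambda>p. \<forall>x. D x p)"
  by (rule regularI') (blast dest: regular_mono, blast intro: regularI)

lemma regular_imp: "regular D \<Longrightarrow> regular (\<lambda>p. A \<longrightarrow> D p)"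
  by (rule regularI') (blast dest: regular_mono, blast intro: regularI)

lemma regular_conj: "regular D \<Longrightarrow> regular E \<Longrightarrow> regular (\<lambda>p. D p \<and> E p)"
  by (rule regularI') (blast dest: regular_mono, blast intro: regularI)

lemma regular_fmem: "regular (\<lambda>p. fmem p a b)"
  unfolding forces_mem_def by (rule regular_dense)

lemma regular_feq: "regular (\<lambda>p. feq p a b)"
  by (subst forces_eq.simps) (intro regular_all regular_conj regular_imp regular_dense)

text \<open>The atomic and existential clauses are built from density statements. For negation, an
  extension forcing \<open>\<phi>\<close> could be extended further to force
  \<open>Neg \<phi>\<close>, while the induction hypothesis keeps \<open>\<phi>\<close> forced
  there.\<close>

lemma regular_forces: "regular (\<lambda>p. forces P le p v \<phi>)"
proof (induction \<phi> arbitrary: v)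
  case (Neg \<phi>)
  note m = regular_mono[OF Neg[of v]]
  show ?case
  proof (rule regularI')
    fix p q assume "forces P le p v (Neg \<phi>)" "q \<preceq> p"
    then show "forces P le q v (Neg \<phi>)" using below_trans by auto
  next
    fix p assume "\<And>q. q \<preceq> p \<Longrightarrow> \<exists>r. r \<preceq> q \<and> forces P le r v (Neg \<phi>)"
    then show "forces P le p v (Neg \<phi>)" using m below_refl' below_carrier by simp meson
  qed
qed (simp_all add: regular_fmem regular_feq regular_conj regular_dense)

lemmas forces_mono = regular_mono[OF regular_forces]
  and feq_mono = regular_mono[OF regular_feq]
  and fmem_mono = regular_mono[OF regular_fmem]

section \<open>Forcing clauses for the derived connectives and quantifiers\<close>

text \<open>Unfolding \<open>Neg\<close> and \<open>And\<close> only gives that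
  \<open>\<psi>\<close> is forced densely below \<open>q\<close>; regularity then yields
  \<open>\<psi>\<close> at \<open>q\<close> itself.\<close>

lemma forces_Imp: "forces P le p v (Imp \<phi> \<psi>) \<longleftrightarrow>
    (\<forall>q. q \<preceq> p \<longrightarrow> forces P le q v \<phi> \<longrightarrow> forces P le q v \<psi>)"
proof
  assume *: "forces P le p v (Imp \<phi> \<psi>)"
  show "\<forall>q. q \<preceq> p \<longrightarrow> forces P le q v \<phi> \<longrightarrow> forces P le q v \<psi>"
  proof (intro allI impI)
    fix q assume q: "q \<preceq> p" "forces P le q v \<phi>"
    show "forces P le q v \<psi>"
    proof (rule regularI[OF regular_forces])
      fix r assume "r \<preceq> q"
      then show "\<exists>r'. r' \<preceq> r \<and> forces P le r' v \<psi>"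
        using * q forces_mono[OF q(2)] below_trans below_carrier by simp meson
    qed
  qed
next
  assume *: "\<forall>q. q \<preceq> p \<longrightarrow> forces P le q v \<phi> \<longrightarrow> forces P le q v \<psi>"
  then show "forces P le p v (Imp \<phi> \<psi>)"
    using below_refl by auto
qed

text \<open>For a fixed name, the two negations of the encoding leave \<open>\<phi>\<close> forced
  densely below \<open>p\<close>, and regularity removes the density. Conversely, an instance forced
  at \<open>p\<close> stays forced below it.\<close>

lemma forces_Forall: "forces P le p v (Forall x \<phi>) \<longleftrightarrow>
    (\<forall>a. name a \<longrightarrow> forces P le p (v(x := a)) \<phi>)"
proof
  assume *: "forces P le p v (Forall x \<phi>)"
  show "\<forall>a. name a \<longrightarrow> forces P le p (v(x := a)) \<phi>"
  proof (intro allI impI)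
    fix a assume a: "name a"
    show "forces P le p (v(x := a)) \<phi>"
    proof (rule regularI[OF regular_forces])
      fix q assume q: "q \<preceq> p"
      have "\<not> dense q (\<lambda>q. \<exists>a. name a \<and> (\<forall>r\<in>elts P. r \<preceq> q \<longrightarrow> \<not> forces P le r (v(x := a)) \<phi>))"
        using * q below_carrier by auto
      then obtain q' where q': "q' \<preceq> q"
        "\<And>r. r \<preceq> q' \<Longrightarrow> \<exists>r'. r' \<preceq> r \<and> forces P le r' (v(x := a)) \<phi>"
        unfolding dense_iff using a by blast
      then show "\<exists>r. r \<preceq> q \<and> forces P le r (v(x := a)) \<phi>"
        using below_refl' below_trans by meson
    qed
  qed
next
  assume *: "\<forall>a. name a \<longrightarrow> forces P le p (v(x := a)) \<phi>"
  then have "forces P le q (v(x := a)) \<phi>" if "name a" "q \<preceq> p" for a q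
    using that forces_mono by blast
  then show "forces P le p v (Forall x \<phi>)"
    by (simp add: dense_iff) (meson below_carrier below_refl below_trans)
qed

lemma forces_And: "forces P le p v (And \<phi> \<psi>) \<longleftrightarrow> forces P le p v \<phi> \<and> forces P le p v \<psi>"
  by simp

lemma forces_Iff: "forces P le p v (Iff \<phi> \<psi>) \<longleftrightarrow>
    (\<forall>q. q \<preceq> p \<longrightarrow> (forces P le q v \<phi> \<longleftrightarrow> forces P le q v \<psi>))"
  unfolding forces_And forces_Imp by blast

lemma forces_Neg: "forces P le p v (Neg \<phi>) \<longleftrightarrow> (\<forall>q. q \<preceq> p \<longrightarrow> \<not> forces P le q v \<phi>)"
  using below_carrier by auto

lemma forces_Or: "forces P le p v (Or \<phi> \<psi>) \<longleftrightarrow>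
    dense p (\<lambda>q. forces P le q v \<phi> \<or> forces P le q v \<psi>)"
  unfolding forces_Neg forces_And dense_iff
  by (meson below_refl' below_trans forces_mono)

lemma forces_Ex: "forces P le p v (Ex x \<phi>) \<longleftrightarrow>
    dense p (\<lambda>q. \<exists>a. name a \<and> forces P le q (v(x := a)) \<phi>)"
  by simp

lemma forces_ExI: "name a \<Longrightarrow> forces P le p (v(x := a)) \<phi> \<Longrightarrow> forces P le p v (Ex x \<phi>)"
  unfolding forces_Ex by (rule dense_all) (blast intro: forces_mono)

lemmas forces_clauses = forces_Iff forces_Imp forces_Or forces_Forall forces_Ex forces_And
  forces.simps(1,2)

section \<open>Forced equality as a congruence\<close>

text \<open>The second clause cannot yet be written with \<open>fmem\<close>, since the recursion
  compares \<open>c\<close> with \<open>d\<close> in the opposite order; \<open>feq_iff_fmem\<close>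
  does so once symmetry is known.\<close>

lemma feq_iff: "feq p a b \<longleftrightarrow>
    (\<forall>c s q. pair c s \<in> elts a \<longrightarrow> q \<preceq> p \<longrightarrow> q \<preceq> s \<longrightarrow> fmem q c b) \<and>
    (\<forall>d t q. pair d t \<in> elts b \<longrightarrow> q \<preceq> p \<longrightarrow> q \<preceq> t \<longrightarrow>
      dense q (\<lambda>r. \<exists>c s. pair c s \<in> elts a \<and> r \<preceq> s \<and> feq r c d))"
proof -
  have "dense p (\<lambda>q. q \<preceq> s \<longrightarrow> D q) \<longleftrightarrow> (\<forall>q. q \<preceq> p \<longrightarrow> q \<preceq> s \<longrightarrow> dense q D)" for s D
    unfolding dense_iff by (meson below_refl' below_trans)
  then show ?thesis
    by (subst forces_eq.simps) (simp add: forces_mem_def)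
qed

lemma feq_refl: "feq p a a"
proof (induction a arbitrary: p rule: wf_induct_rule[OF wf_trancl[OF wf_mem_rel]])
  case (1 a)
  then show ?case
    unfolding feq_iff[of p a a] forces_mem_def
    by (intro conjI allI impI dense_all) (meson pair_mem_trancl below_trans)+
qed

text \<open>Induction on the first name: for \<open>c\<close> occurring in \<open>a\<close> the
  hypothesis swaps \<open>feq q c d\<close>, which turns each half of the definition for
  \<open>a\<close>, \<open>b\<close> into the other half for \<open>b\<close>,
  \<open>a\<close>.\<close>

lemma feq_commute: "feq p a b \<longleftrightarrow> feq p b a"
proof (induction a arbitrary: p b rule: wf_induct_rule[OF wf_trancl[OF wf_mem_rel]])
  case (1 a)
  then have *: "pair c s \<in> elts a \<Longrightarrow> feq q c d \<longleftrightarrow> feq q d c" for c s q d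
    using pair_mem_trancl by blast
  have A: "dense q (\<lambda>r. \<exists>c s. pair c s \<in> elts a \<and> r \<preceq> s \<and> feq r c d) \<longleftrightarrow> fmem q d a" for q d
    unfolding forces_mem_def by (rule dense_cong) (metis *)
  have B: "dense q (\<lambda>r. \<exists>d t. pair d t \<in> elts b \<and> r \<preceq> t \<and> feq r d c) \<longleftrightarrow> fmem q c b"
    if "pair c s \<in> elts a" for q c s
    unfolding forces_mem_def by (rule dense_cong) (metis *[OF that])
  show ?case
    unfolding feq_iff[of p a b] feq_iff[of p b a] A using B by blast
qed

lemma feq_sym: "feq p a b \<Longrightarrow> feq p b a"
  using feq_commute by blast

lemma feq_iff_fmem: "feq p a b \<longleftrightarrow>
    (\<forall>c s q. pair c s \<in> elts a \<longrightarrow> q \<preceq> p \<longrightarrow> q \<preceq> s \<longrightarrow> fmem q c b) \<and>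
    (\<forall>d t q. pair d t \<in> elts b \<longrightarrow> q \<preceq> p \<longrightarrow> q \<preceq> t \<longrightarrow> fmem q d a)"
  by (subst feq_iff) (simp add: forces_mem_def feq_commute)

lemma fmemE:
  assumes "fmem p a b" "q \<preceq> p"
  obtains r c s where "r \<preceq> q" "pair c s \<in> elts b" "r \<preceq> s" "feq r a c"
  using assms unfolding forces_mem_def by (blast elim: denseE)

lemma fmemI: "pair c s \<in> elts b \<Longrightarrow> p \<preceq> s \<Longrightarrow> feq p a c \<Longrightarrow> fmem p a b"
  unfolding forces_mem_def by (rule dense_all) (meson below_trans feq_mono)

text \<open>A member of \<open>a\<close> is densely equal to a member of \<open>b\<close>, and that
  one densely to a member of \<open>c\<close>. The induction hypothesis composes the two equalities,
  and regularity of membership absorbs the extensions.\<close>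

lemma feq_trans: "feq p a b \<Longrightarrow> feq p b c \<Longrightarrow> feq p a c"
proof (induction a arbitrary: p b c rule: wf_induct_rule[OF wf_trancl[OF wf_mem_rel]])
  case (1 a)
  then have ih: "feq q x z" if "pair x s \<in> elts a" "feq q x y" "feq q y z" for q x s y z
    using that pair_mem_trancl by blast
  show ?case
    unfolding feq_iff_fmem[of p a c]
  proof (intro conjI allI impI)
    fix x s q assume x: "pair x s \<in> elts a" "q \<preceq> p" "q \<preceq> s"
    then have "fmem q x b" using 1(2) by (simp add: feq_iff_fmem)
    show "fmem q x c"
    proof (rule regularI[OF regular_fmem])
      fix q' assume q': "q' \<preceq> q"
      obtain r y t where y: "r \<preceq> q'" "pair y t \<in> elts b" "r \<preceq> t" "feq r x y"
        using \<open>fmem q x b\<close> q' by (rule fmemE)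
      then have "fmem r y c" using 1(3) q' x(2) below_trans unfolding feq_iff_fmem[of p b] by meson
      then obtain r' z u where z: "r' \<preceq> r" "pair z u \<in> elts c" "r' \<preceq> u" "feq r' y z"
        using y(1) below_refl' fmemE by metis
      then have "feq r' x z" using ih x(1) y(4) feq_mono by blast
      then show "\<exists>r. r \<preceq> q' \<and> fmem r x c" using z y(1) fmemI below_trans by blast
    qed
  next
    fix z u q assume z: "pair z u \<in> elts c" "q \<preceq> p" "q \<preceq> u"
    then have "fmem q z b" using 1(3) by (simp add: feq_iff_fmem)
    show "fmem q z a"
    proof (rule regularI[OF regular_fmem])
      fix q' assume q': "q' \<preceq> q"
      obtain r y t where y: "r \<preceq> q'" "pair y t \<in> elts b" "r \<preceq> t" "feq r z y"
        using \<open>fmem q z b\<close> q' by (rule fmemE)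
      then have "fmem r y a" using 1(2) q' z(2) below_trans unfolding feq_iff_fmem[of p a] by meson
      then obtain r' x s where x: "r' \<preceq> r" "pair x s \<in> elts a" "r' \<preceq> s" "feq r' y x"
        using y(1) below_refl' fmemE by metis
      then have "feq r' x z" using ih[OF x(2)] y(4) feq_mono feq_sym by blast
      then show "\<exists>r. r \<preceq> q' \<and> fmem r z a" using x y(1) fmemI below_trans feq_sym by blast
    qed
  qed
qed

lemma fmem_cong_left: assumes "feq p a a'" "fmem p a b" shows "fmem p a' b"
proof (rule regularI[OF regular_fmem])
  fix q assume "q \<preceq> p"
  with assms(2) obtain r c s where "r \<preceq> q" "pair c s \<in> elts b" "r \<preceq> s" "feq r a c"
    by (rule fmemE)
  moreover have "feq r a a'" using assms(1) \<open>q \<preceq> p\<close> \<open>r \<preceq> q\<close> by (blast intro: feq_mono)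
  ultimately show "\<exists>r. r \<preceq> q \<and> fmem r a' b" by (meson fmemI feq_sym feq_trans)
qed

lemma fmem_cong_right: assumes "feq p b b'" "fmem p a b" shows "fmem p a b'"
proof (rule regularI[OF regular_fmem])
  fix q assume "q \<preceq> p"
  with assms(2) obtain r c s where r: "r \<preceq> q" "pair c s \<in> elts b" "r \<preceq> s" "feq r a c"
    by (rule fmemE)
  then have "fmem r c b'"
    using assms(1) \<open>q \<preceq> p\<close> below_trans unfolding feq_iff_fmem[of p b] by meson
  then show "\<exists>r. r \<preceq> q \<and> fmem r a b'" using r(1,4) fmem_cong_left feq_sym by blast
qed

lemma fmem_cong:
  "feq p a a' \<Longrightarrow> feq p b b' \<Longrightarrow> fmem p a b \<longleftrightarrow> fmem p a' b'"
  using fmem_cong_left fmem_cong_right feq_sym by meson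

text \<open>Equality at \<open>p\<close> persists to all conditions below, as the clauses for
  \<open>Neg\<close> and \<open>Ex\<close> require. Finiteness is later transferred along forced
  equality in this way.\<close>

lemma forces_cong:
  assumes "\<And>i. feq p (v i) (v' i)" shows "forces P le p v \<phi> \<longleftrightarrow> forces P le p v' \<phi>"
  using assms
proof (induction \<phi> arbitrary: p v v')
  case (Mem x y) then show ?case using fmem_cong by simp
next
  case (Eq x y) then show ?case by simp (meson feq_sym feq_trans)
next
  case (Neg \<phi>)
  then have "forces P le q v \<phi> \<longleftrightarrow> forces P le q v' \<phi>" if "q \<preceq> p" for q
    using that feq_mono by blast
  then show ?case by (simp add: forces_Neg)
next
  case (And \<phi> \<psi>)
  then have "forces P le p v \<phi> \<longleftrightarrow> forces P le p v' \<phi>" "forces P le p v \<psi> \<longleftrightarrow> forces P le p v' \<psi>"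
    by blast+
  then show ?case by simp
next
  case (Ex x \<phi>)
  have "forces P le q (v(x := a)) \<phi> \<longleftrightarrow> forces P le q (v'(x := a)) \<phi>" if "q \<preceq> p" for q a
    by (rule Ex.IH) (simp add: feq_refl feq_mono[OF Ex.prems that])
  then show ?case unfolding forces_Ex by (intro dense_cong) simp
qed


section \<open>Names\<close>

text \<open>In the extension, \<open>c\<close> becomes a member once the generic filter contains
  some \<open>r\<close> with \<open>R c r\<close>. \<open>cname\<close> attaches every condition,
  since the poset may lack a largest element.\<close>

definition mkname :: "'v set \<Rightarrow> ('v \<Rightarrow> 'v \<Rightarrow> bool) \<Rightarrow> 'v" where
  "mkname C R = set_of {pair c r | c r. c \<in> C \<and> r \<in> elts P \<and> R c r}"

abbreviation cname :: "'v set \<Rightarrow> 'v" where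
  "cname C \<equiv> mkname C (\<lambda>_ _. True)"

lemma elts_mkname:
  assumes "small C"
  shows "elts (mkname C R) = {pair c r | c r. c \<in> C \<and> r \<in> elts P \<and> R c r}"
proof -
  have "small (\<Union>c\<in>C. (\<lambda>r. pair c r) ` elts P)"
    by (intro small_UN small_image assms small_elts)
  then have "small {pair c r | c r. c \<in> C \<and> r \<in> elts P \<and> R c r}"
    by (rule small_subset) blast
  then show ?thesis unfolding mkname_def by (rule elts_set_of)
qed

lemma name_mkname: "small C \<Longrightarrow> (\<And>c. c \<in> C \<Longrightarrow> name c) \<Longrightarrow> name (mkname C R)"
  by (rule is_name.intros) (auto simp: elts_mkname)

lemma fmem_mkname: "small C \<Longrightarrow>
    fmem p a (mkname C R) \<longleftrightarrow> dense p (\<lambda>q. \<exists>c\<in>C. \<exists>r. q \<preceq> r \<and> R c r \<and> feq q a c)"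
  unfolding forces_mem_def
  by (intro arg_cong[of _ _ "dense p"] ext) (auto simp: elts_mkname dest: below_carrier)

lemma fmem_cname:
  assumes "small C" shows "fmem p a (cname C) \<longleftrightarrow> dense p (\<lambda>q. \<exists>c\<in>C. feq q a c)"
  unfolding fmem_mkname[OF assms]
  by (rule dense_cong) (use below_refl' in blast)

lemma fmem_cnameI: "small C \<Longrightarrow> c \<in> C \<Longrightarrow> feq p a c \<Longrightarrow> fmem p a (cname C)"
  unfolding fmem_cname by (rule dense_all) (blast intro: feq_mono)

lemma name_elt: "name a \<Longrightarrow> pair c s \<in> elts a \<Longrightarrow> name c"
  by (erule is_name.cases) (metis pair_inject)

text \<open>Testing on names suffices because every member occurring in a name is a name. Forced
  formulas quantify over names only, so this is the form in which extensionality applies to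
  them.\<close>

lemma feq_ext:
  assumes "name a" "name b"
  shows "feq p a b \<longleftrightarrow> (\<forall>q c. q \<preceq> p \<longrightarrow> name c \<longrightarrow> fmem q c a \<longleftrightarrow> fmem q c b)"
proof
  assume "feq p a b"
  then show "\<forall>q c. q \<preceq> p \<longrightarrow> name c \<longrightarrow> fmem q c a \<longleftrightarrow> fmem q c b"
    using fmem_cong feq_refl feq_mono by metis
next
  assume "\<forall>q c. q \<preceq> p \<longrightarrow> name c \<longrightarrow> fmem q c a \<longleftrightarrow> fmem q c b"
  then show "feq p a b"
    unfolding feq_iff_fmem using assms name_elt fmemI feq_refl by meson
qed

section \<open>Canonical names of ground-model sets\<close>

lemma check_eq: "check P x = cname (check P ` elts x)"
proof -
  have "(\<Union>y\<in>elts x. pair (check P y) ` elts P) = {pair c r | c r. c \<in> check P ` elts x \<and> r \<in> elts P \<and> True}"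
    by auto
  then show ?thesis by (subst check.simps) (simp add: mkname_def)
qed

lemma small_check [simp]: "small (check P ` elts x)"
  by (intro small_image small_elts)

lemma name_check [simp]: "name (check P x)"
proof (induction x rule: wf_induct_rule[OF wf_mem_rel])
  case (1 x)
  show ?case by (subst check_eq) (auto intro!: name_mkname 1 simp: mem_rel_def)
qed

lemma fmem_check: "fmem p a (check P x) \<longleftrightarrow> dense p (\<lambda>q. \<exists>y\<in>elts x. feq q a (check P y))"
  by (subst check_eq) (simp add: fmem_cname)

lemma fmem_checkE:
  assumes "fmem p a (check P x)" "q \<preceq> p"
  obtains r y where "r \<preceq> q" "y \<in> elts x" "feq r a (check P y)"
  using assms unfolding fmem_check by (blast elim: denseE)

lemma fmem_checkI: "y \<in> elts x \<Longrightarrow> feq p a (check P y) \<Longrightarrow> fmem p a (check P x)"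
  unfolding fmem_check by (rule dense_all) (blast intro: feq_mono)

text \<open>Some condition below \<open>p\<close> matches a given element with a concrete element of
  the other set, and the induction hypothesis turns that forced equality into a real one.
  \<open>p \<in> elts P\<close> provides such a condition; outside \<open>P\<close> every equality
  is forced.\<close>

lemma feq_check_eq: "p \<in> elts P \<Longrightarrow> feq p (check P x) (check P y) \<Longrightarrow> x = y"
proof (induction x arbitrary: p y rule: wf_induct_rule[OF wf_mem_rel])
  case (1 x)
  then have ih: "z = w" if "z \<in> elts x" "q \<in> elts P" "feq q (check P z) (check P w)" for z w q
    using that by (auto simp: mem_rel_def)
  have "z \<in> elts y" if "z \<in> elts x" for z
  proof -
    have "fmem p (check P z) (check P y)"
      using fmem_checkI[OF that feq_refl] 1(3) by (rule fmem_cong_right[rotated])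
    then obtain r w where "r \<preceq> p" "w \<in> elts y" "feq r (check P z) (check P w)"
      using below_refl[OF 1(2)] by (rule fmem_checkE)
    then show ?thesis using ih that below_carrier by blast
  qed
  moreover have "z \<in> elts x" if "z \<in> elts y" for z
  proof -
    have "fmem p (check P z) (check P x)"
      using fmem_checkI[OF that feq_refl] feq_sym[OF 1(3)] by (rule fmem_cong_right[rotated])
    then obtain r w where "r \<preceq> p" "w \<in> elts x" "feq r (check P z) (check P w)"
      using below_refl[OF 1(2)] by (rule fmem_checkE)
    then show ?thesis using ih below_carrier feq_sym by metis
  qed
  ultimately show ?case by (intro extensionality) blast
qed

lemma fmem_check_mem: assumes "p \<in> elts P" "fmem p (check P x) (check P y)" shows "x \<in> elts y"
  using assms by (metis below_carrier(1) below_refl feq_check_eq fmem_checkE)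

section \<open>Names for unordered and ordered pairs\<close>

definition upn :: "'v \<Rightarrow> 'v \<Rightarrow> 'v" where
  "upn a b = cname {a, b}"

definition pairn :: "'v \<Rightarrow> 'v \<Rightarrow> 'v" where
  "pairn a b = upn (upn a a) (upn a b)"

lemma name_upn: "name a \<Longrightarrow> name b \<Longrightarrow> name (upn a b)"
  unfolding upn_def by (rule name_mkname) auto

lemma name_pairn: "name a \<Longrightarrow> name b \<Longrightarrow> name (pairn a b)"
  unfolding pairn_def by (intro name_upn)

lemma fmem_upn: "fmem p c (upn a b) \<longleftrightarrow> dense p (\<lambda>q. feq q c a \<or> feq q c b)"
  by (simp add: upn_def fmem_cname)

lemma fmem_upn_same: "fmem p c (upn a a) \<longleftrightarrow> feq p c a"
  unfolding fmem_upn disj_absorb by (rule regular_feq[unfolded regular_def, rule_format, symmetric])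

lemma fmem_upnI: "fmem p a (upn a b)" "fmem p b (upn a b)"
  by (simp_all add: fmem_upn feq_refl dense_all)

lemma fmem_upnE:
  assumes "fmem p c (upn a b)" "q \<preceq> p"
  obtains r where "r \<preceq> q" "feq r c a \<or> feq r c b"
  using assms unfolding fmem_upn by (blast elim: denseE)

lemma feq_upn: assumes "feq p a a'" "feq p b b'" shows "feq p (upn a b) (upn a' b')"
proof -
  have "fmem q c (upn a b) \<longleftrightarrow> fmem q c (upn a' b')" if "q \<preceq> p" for q c
    unfolding fmem_upn
  proof (rule dense_cong)
    fix r assume "r \<preceq> q"
    then have "feq r a a'" "feq r b b'" using assms that below_trans feq_mono by blast+
    then show "feq r c a \<or> feq r c b \<longleftrightarrow> feq r c a' \<or> feq r c b'" by (meson feq_sym feq_trans)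
  qed
  then show ?thesis
    unfolding feq_iff_fmem using fmemI feq_refl by meson
qed

lemma feq_pairn: "feq p a a' \<Longrightarrow> feq p b b' \<Longrightarrow> feq p (pairn a b) (pairn a' b')"
  unfolding pairn_def by (intro feq_upn)

lemma feq_upn_same: assumes "feq p (upn c d) (upn a a)" shows "feq p c a" "feq p d a"
  using fmem_cong_right[OF assms] fmem_upnI unfolding fmem_upn_same by blast+

text \<open>The classical argument for Kuratowski pairs, with every case distinction made on a dense
  set of conditions and then removed by regularity of equality.\<close>

lemma feq_pairn_iff: "feq p (pairn a b) (pairn c d) \<longleftrightarrow> feq p a c \<and> feq p b d"
proof
  assume eq: "feq p (pairn a b) (pairn c d)"
  have ac: "feq p a c"
  proof (rule regular_dense_use[OF regular_feq])
    show "dense p (\<lambda>q. feq q (upn a a) (upn c c) \<or> feq q (upn a a) (upn c d))"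
      using fmem_cong_right[OF eq] fmem_upnI(1) unfolding pairn_def fmem_upn by blast
    show "feq q a c" if "feq q (upn a a) (upn c c) \<or> feq q (upn a a) (upn c d)" for q
      using that feq_upn_same feq_sym by meson
  qed
  moreover have "feq p b d"
  proof (rule regular_dense_use[OF regular_feq])
    have eq1: "dense p (\<lambda>q. feq q (upn a b) (upn c c) \<or> feq q (upn a b) (upn c d))"
      using fmem_cong_right[OF eq] fmem_upnI(2) unfolding pairn_def fmem_upn by blast
    have eq2: "dense p (\<lambda>q. feq q (upn c d) (upn a a) \<or> feq q (upn c d) (upn a b))"
      using fmem_cong_right[OF feq_sym[OF eq]] fmem_upnI(2) unfolding pairn_def fmem_upn by blast
    \<comment> \<open>The two disjunctions are settled one after the other, so that a single
      condition carries both choices.\<close>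
    show "dense p (\<lambda>q. (feq q (upn a b) (upn c c) \<or> feq q (upn a b) (upn c d)) \<and>
        (feq q (upn c d) (upn a a) \<or> feq q (upn c d) (upn a b)))"
      unfolding dense_iff
    proof (intro allI impI)
      fix q assume "q \<preceq> p"
      then obtain r where r: "r \<preceq> q" "feq r (upn a b) (upn c c) \<or> feq r (upn a b) (upn c d)"
        by (rule denseE[OF eq1])
      have "r \<preceq> p" using r(1) \<open>q \<preceq> p\<close> by (rule below_trans)
      then obtain r' where "r' \<preceq> r" "feq r' (upn c d) (upn a a) \<or> feq r' (upn c d) (upn a b)"
        by (rule denseE[OF eq2])
      then show "\<exists>r. r \<preceq> q \<and> (feq r (upn a b) (upn c c) \<or> feq r (upn a b) (upn c d)) \<and>
        (feq r (upn c d) (upn a a) \<or> feq r (upn c d) (upn a b))"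
        using r below_trans feq_mono by blast
    qed
    fix q assume q: "q \<preceq> p" "(feq q (upn a b) (upn c c) \<or> feq q (upn a b) (upn c d)) \<and>
        (feq q (upn c d) (upn a a) \<or> feq q (upn c d) (upn a b))"
    have ac: "feq q a c" using ac q(1) by (rule feq_mono)
    \<comment> \<open>Two equal doubletons with \<open>a = c\<close>: either \<open>b = d\<close> at
      once, or \<open>b = c\<close> and \<open>d = a\<close>, which again identifies
      \<open>b\<close> with \<open>d\<close>.\<close>
    have both: "feq q b d" if eq: "feq q (upn a b) (upn c d)"
    proof (rule regularI[OF regular_feq])
      fix r assume r: "r \<preceq> q"
      have "fmem q b (upn c d)" "fmem q d (upn a b)"
        using fmem_cong_right[OF eq] fmem_cong_right[OF feq_sym[OF eq]] fmem_upnI by blast+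
      then obtain r' where r': "r' \<preceq> r" "feq r' b c \<or> feq r' b d"
        using r by (blast elim: fmem_upnE)
      then obtain r'' where r'': "r'' \<preceq> r'" "feq r'' d a \<or> feq r'' d b"
        using \<open>fmem q d (upn a b)\<close> r by (meson fmem_upnE below_trans)
      have "r'' \<preceq> q" using r r' r'' below_trans by blast
      then have "feq r'' a c" "feq r'' b c \<or> feq r'' b d"
        using ac r'(2) r''(1) feq_mono by blast+
      then have "feq r'' b d" using r''(2) by (meson feq_sym feq_trans)
      then show "\<exists>r'. r' \<preceq> r \<and> feq r' b d" using r' r'' below_trans by blast
    qed
    show "feq q b d"
    proof (cases "feq q (upn a b) (upn c d) \<or> feq q (upn c d) (upn a b)")
      case True then show ?thesis using both feq_sym by blast
    next
      \<comment> \<open>Here both doubletons collapse to singletons, so all four components are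
        equal.\<close>
      case False
      then have "feq q (upn a b) (upn c c)" "feq q (upn c d) (upn a a)" using q by blast+
      then show ?thesis using ac by (meson feq_upn_same feq_sym feq_trans)
    qed
  qed
  ultimately show "feq p a c \<and> feq p b d" ..
qed (simp add: feq_pairn)

section \<open>Forcing the set-theoretic vocabulary\<close>

text \<open>This and the following predicates are the forcing clauses of the corresponding formulas,
  stated for names instead of valuations so that variable indices disappear.\<close>

definition fsub :: "'v \<Rightarrow> 'v \<Rightarrow> 'v \<Rightarrow> bool" where
  "fsub p a b \<longleftrightarrow> (\<forall>c q. name c \<longrightarrow> q \<preceq> p \<longrightarrow> fmem q c a \<longrightarrow> fmem q c b)"

definition fUnion :: "'v \<Rightarrow> 'v \<Rightarrow> 'v \<Rightarrow> bool" where
  "fUnion p a u \<longleftrightarrow> (\<forall>c q. name c \<longrightarrow> q \<preceq> p \<longrightarrow>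
     (fmem q c a \<longleftrightarrow> dense q (\<lambda>r. \<exists>y. name y \<and> fmem r y u \<and> fmem r c y)))"

definition fempty :: "'v \<Rightarrow> 'v \<Rightarrow> bool" where
  "fempty p a \<longleftrightarrow> (\<forall>c q. name c \<longrightarrow> q \<preceq> p \<longrightarrow> \<not> fmem q c a)"

definition fsucc :: "'v \<Rightarrow> 'v \<Rightarrow> 'v \<Rightarrow> bool" where
  "fsucc p b a \<longleftrightarrow> (\<forall>c q. name c \<longrightarrow> q \<preceq> p \<longrightarrow>
     (fmem q c b \<longleftrightarrow> dense q (\<lambda>r. fmem r c a \<or> feq r c a)))"

definition finductive :: "'v \<Rightarrow> 'v \<Rightarrow> bool" where
  "finductive p w \<longleftrightarrow> dense p (\<lambda>q. \<exists>n. name n \<and> fmem q n w \<and> fempty q n) \<and>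
     (\<forall>n q. name n \<longrightarrow> q \<preceq> p \<longrightarrow> fmem q n w \<longrightarrow>
        dense q (\<lambda>r. \<exists>m. name m \<and> fmem r m w \<and> fsucc r m n))"

definition ffun :: "'v \<Rightarrow> 'v \<Rightarrow> 'v \<Rightarrow> bool" where
  "ffun p f d \<longleftrightarrow>
     (\<forall>z q. name z \<longrightarrow> q \<preceq> p \<longrightarrow> fmem q z f \<longrightarrow>
        dense q (\<lambda>r. \<exists>x. name x \<and> fmem r x d \<and> dense r (\<lambda>r'. \<exists>y. name y \<and> feq r' z (pairn x y)))) \<and>
     (\<forall>x q. name x \<longrightarrow> q \<preceq> p \<longrightarrow> fmem q x d \<longrightarrow>
        dense q (\<lambda>r. \<exists>y. name y \<and> fmem r (pairn x y) f \<and>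
          (\<forall>y' r'. name y' \<longrightarrow> r' \<preceq> r \<longrightarrow> fmem r' (pairn x y') f \<longrightarrow> feq r' y' y)))"

lemma forces_sub: "forces P le p v (fm_sub x y) \<longleftrightarrow> fsub p (v x) (v y)"
  unfolding fm_sub_def Let_def forces_clauses fsub_def by auto

lemma forces_Union: "forces P le p v (fm_Union x u) \<longleftrightarrow> fUnion p (v x) (v u)"
  unfolding fm_Union_def Let_def forces_Forall forces_Iff
  unfolding forces_clauses fUnion_def by simp

lemma forces_empty: "forces P le p v (fm_empty x) \<longleftrightarrow> fempty p (v x)"
  unfolding fm_empty_def Let_def forces_Forall unfolding forces_Neg fempty_def by auto

lemma forces_succ: "forces P le p v (fm_succ y x) \<longleftrightarrow> fsucc p (v y) (v x)"
  unfolding fm_succ_def Let_def forces_Forall forces_Iff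
  unfolding forces_Or fsucc_def by simp

lemma forces_inductive: "forces P le p v (fm_inductive w) \<longleftrightarrow> finductive p (v w)"
  unfolding fm_inductive_def Let_def forces_clauses forces_empty forces_succ finductive_def by auto

text \<open>The formula compares members over names, and \<open>feq_ext\<close> turns this into
  equality; hence the requirement that the three values be names.\<close>

lemma forces_upair:
  assumes "name (v z)" "name (v x)" "name (v y)"
  shows "forces P le p v (fm_upair z x y) \<longleftrightarrow> feq p (v z) (upn (v x) (v y))"
  unfolding fm_upair_def Let_def forces_Forall forces_Iff
  unfolding forces_Or
  using assms by (auto simp: feq_ext name_upn fmem_upn)

text \<open>The quantified singleton and doubleton are forced equal to \<open>upn\<close> names;
  conversely, these names serve as the witnesses.\<close>

lemma forces_pair:
  assumes "name (v z)" "name (v x)" "name (v y)"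
  shows "forces P le p v (fm_pair z x y) \<longleftrightarrow> feq p (v z) (pairn (v x) (v y))"
proof -
  have "forces P le p v (fm_pair z x y) \<longleftrightarrow> dense p (\<lambda>q. \<exists>a. name a \<and> dense q (\<lambda>r. \<exists>b. name b \<and>
      feq r a (upn (v x) (v x)) \<and> feq r b (upn (v x) (v y)) \<and> feq r (v z) (upn a b)))"
    using assms
    by (simp add: fm_pair_def Let_def forces_Ex forces_And forces_upair cong: conj_cong del: forces.simps)
  also have "\<dots> \<longleftrightarrow> feq p (v z) (pairn (v x) (v y))"
  proof
    assume *: "dense p (\<lambda>q. \<exists>a. name a \<and> dense q (\<lambda>r. \<exists>b. name b \<and>
      feq r a (upn (v x) (v x)) \<and> feq r b (upn (v x) (v y)) \<and> feq r (v z) (upn a b)))"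
    show "feq p (v z) (pairn (v x) (v y))"
    proof (rule regular_dense_use[OF regular_feq *], elim exE conjE)
      fix q a assume *: "dense q (\<lambda>r. \<exists>b. name b \<and>
        feq r a (upn (v x) (v x)) \<and> feq r b (upn (v x) (v y)) \<and> feq r (v z) (upn a b))"
      show "feq q (v z) (pairn (v x) (v y))"
        by (rule regular_dense_use[OF regular_feq *], unfold pairn_def) (meson feq_trans feq_upn)
    qed
  next
    assume *: "feq p (v z) (pairn (v x) (v y))"
    have "feq r (v z) (upn (upn (v x) (v x)) (upn (v x) (v y)))" if "q \<preceq> p" "r \<preceq> q" for q r
      using feq_mono[OF *] below_trans that unfolding pairn_def by blast
    then show "dense p (\<lambda>q. \<exists>a. name a \<and> dense q (\<lambda>r. \<exists>b. name b \<and>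
      feq r a (upn (v x) (v x)) \<and> feq r b (upn (v x) (v y)) \<and> feq r (v z) (upn a b)))"
      by (intro dense_all, intro exI[of _ "upn (v x) (v x)"],
          intro conjI dense_all exI[of _ "upn (v x) (v y)"] name_upn assms feq_refl)
  qed
  finally show ?thesis .
qed

lemma forces_app:
  assumes "name (v x)" "name (v y)"
  shows "forces P le p v (fm_app f x y) \<longleftrightarrow> fmem p (pairn (v x) (v y)) (v f)"
proof -
  have "forces P le p v (fm_app f x y) \<longleftrightarrow>
      dense p (\<lambda>q. \<exists>z. name z \<and> fmem q z (v f) \<and> feq q z (pairn (v x) (v y)))"
    using assms
    by (simp add: fm_app_def Let_def forces_Ex forces_And forces_pair cong: conj_cong del: forces.simps(3-))
  also have "\<dots> \<longleftrightarrow> fmem p (pairn (v x) (v y)) (v f)"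
  proof
    show "fmem p (pairn (v x) (v y)) (v f)"
      if "dense p (\<lambda>q. \<exists>z. name z \<and> fmem q z (v f) \<and> feq q z (pairn (v x) (v y)))"
      by (rule regular_dense_use[OF regular_fmem that]) (blast intro: fmem_cong_left)
    show "dense p (\<lambda>q. \<exists>z. name z \<and> fmem q z (v f) \<and> feq q z (pairn (v x) (v y)))"
      if "fmem p (pairn (v x) (v y)) (v f)"
      using that assms
      by (intro dense_all exI[of _ "pairn (v x) (v y)"]) (simp add: name_pairn feq_refl fmem_mono)
  qed
  finally show ?thesis .
qed

lemma forces_fun:
  assumes "name (v d)"
  shows "forces P le p v (fm_fun f d) \<longleftrightarrow> ffun p (v f) (v d)"
  unfolding fm_fun_def Let_def ffun_def using assms
  by (simp add: forces_clauses forces_pair forces_app cong: conj_cong del: forces.simps(3-))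

lemma fsubD: "fsub p a b \<Longrightarrow> name c \<Longrightarrow> q \<preceq> p \<Longrightarrow> fmem q c a \<Longrightarrow> fmem q c b"
  unfolding fsub_def by blast

lemma fUnion_mono: "fUnion p a u \<Longrightarrow> q \<preceq> p \<Longrightarrow> fUnion q a u"
  unfolding fUnion_def using below_trans by blast

lemma fUnionE:
  assumes "fUnion p a u" "name c" "fmem p c a" "q \<preceq> p"
  obtains r y where "r \<preceq> q" "name y" "fmem r y u" "fmem r c y"
proof -
  have "dense p (\<lambda>r. \<exists>y. name y \<and> fmem r y u \<and> fmem r c y)"
    using assms below_refl' below_carrier below_refl unfolding fUnion_def by meson
  then show thesis using assms(4) that by (auto elim: denseE)
qed

lemma fUnionI:
  assumes "fUnion p a u" "name c" "q \<preceq> p" "name y" "fmem q y u" "fmem q c y"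
  shows "fmem q c a"
proof -
  have "dense q (\<lambda>r. \<exists>y. name y \<and> fmem r y u \<and> fmem r c y)"
    using assms by (intro dense_all exI[of _ y]) (simp add: fmem_mono)
  then show ?thesis using assms unfolding fUnion_def by blast
qed

section \<open>Natural numbers and omega in the extension\<close>

abbreviation om :: 'v where
  "om \<equiv> set_of (range nat_of)"

abbreviation ncheck :: "nat \<Rightarrow> 'v" where
  "ncheck k \<equiv> check P (nat_of k)"

lemma fempty_ncheck: "fempty p (ncheck 0)"
  unfolding fempty_def fmem_check dense_iff using below_refl' by auto

lemma fempty_unique: "fempty p n \<Longrightarrow> name n \<Longrightarrow> feq p n (ncheck 0)"
  using fempty_ncheck[of p] unfolding fempty_def by (simp add: feq_ext)

lemma fsucc_ncheck: "fsucc p (ncheck (Suc k)) (ncheck k)"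
  unfolding fsucc_def
proof (intro allI impI iffI)
  fix c q assume "fmem q c (ncheck (Suc k))"
  then show "dense q (\<lambda>r. fmem r c (ncheck k) \<or> feq r c (ncheck k))"
    unfolding fmem_check[of _ _ "nat_of (Suc k)"] by (rule dense_weaken) (auto intro: fmem_checkI)
next
  fix c q assume *: "dense q (\<lambda>r. fmem r c (ncheck k) \<or> feq r c (ncheck k))"
  show "fmem q c (ncheck (Suc k))"
  proof (rule regular_dense_use[OF regular_fmem *])
    fix r assume "fmem r c (ncheck k) \<or> feq r c (ncheck k)"
    then show "fmem r c (ncheck (Suc k))"
    proof
      assume "fmem r c (ncheck k)"
      then show ?thesis
        unfolding fmem_check by (rule dense_weaken) auto
    qed (rule fmem_checkI[of "nat_of k"], simp_all)
  qed
qed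

lemma fsucc_unique:
  assumes "fsucc p m n" "name m" "feq p n (ncheck k)" shows "feq p m (ncheck (Suc k))"
proof -
  have "fmem q c m \<longleftrightarrow> fmem q c (ncheck (Suc k))" if "q \<preceq> p" "name c" for q c
  proof -
    have "dense q (\<lambda>r. fmem r c n \<or> feq r c n) \<longleftrightarrow>
        dense q (\<lambda>r. fmem r c (ncheck k) \<or> feq r c (ncheck k))"
    proof (rule dense_cong)
      fix r assume "r \<preceq> q"
      then have "feq r n (ncheck k)" using assms(3) that(1) below_trans feq_mono by blast
      then show "fmem r c n \<or> feq r c n \<longleftrightarrow> fmem r c (ncheck k) \<or> feq r c (ncheck k)"
        by (meson feq_refl feq_sym feq_trans fmem_cong)
    qed
    then show ?thesis
      using assms(1) fsucc_ncheck[of p k] that unfolding fsucc_def by simp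
  qed
  then show ?thesis using assms(2) by (simp add: feq_ext)
qed

lemma ncheck_omE:
  assumes "fmem p n (check P om)" "q \<preceq> p"
  obtains r k where "r \<preceq> q" "feq r n (ncheck k)"
proof -
  obtain r y where "r \<preceq> q" "y \<in> elts om" "feq r n (check P y)"
    using assms by (rule fmem_checkE)
  then show thesis using that by (auto simp: elts_omega)
qed

lemma fmem_ncheck_om: "fmem p (ncheck k) (check P om)"
  by (rule fmem_checkI[OF _ feq_refl]) (simp add: elts_omega)

lemma finductive_om: "finductive p (check P om)"
  unfolding finductive_def
proof (intro conjI allI impI)
  show "dense p (\<lambda>q. \<exists>n. name n \<and> fmem q n (check P om) \<and> fempty q n)"
    using fempty_ncheck fmem_ncheck_om name_check by (intro dense_all) blast
next
  fix n q assume n: "fmem q n (check P om)" "name n"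
  show "dense q (\<lambda>r. \<exists>m. name m \<and> fmem r m (check P om) \<and> fsucc r m n)"
  proof (rule denseI)
    fix q' assume "q' \<preceq> q"
    with n(1) obtain r k where r: "r \<preceq> q'" "feq r n (ncheck k)" by (rule ncheck_omE)
    have "dense r' (\<lambda>s. fmem s c n \<or> feq s c n) \<longleftrightarrow>
        dense r' (\<lambda>s. fmem s c (ncheck k) \<or> feq s c (ncheck k))" if "r' \<preceq> r" for r' c
    proof (rule dense_cong)
      fix s assume "s \<preceq> r'"
      then have "feq s n (ncheck k)" using r(2) that below_trans feq_mono by blast
      then show "fmem s c n \<or> feq s c n \<longleftrightarrow> fmem s c (ncheck k) \<or> feq s c (ncheck k)"
        by (meson feq_refl feq_sym feq_trans fmem_cong)
    qed
    then have "fsucc r (ncheck (Suc k)) n"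
      using fsucc_ncheck[of r k] unfolding fsucc_def by simp
    then show "\<exists>r. r \<preceq> q' \<and> (\<exists>m. name m \<and> fmem r m (check P om) \<and> fsucc r m n)"
      using r(1) fmem_ncheck_om name_check by blast
  qed
qed

text \<open>Induction in the ground model: an inductive name densely contains an empty name and
  successors of its members, and these are forced equal to the canonical ones.\<close>

lemma finductive_ncheck:
  assumes "finductive p z" shows "fmem p (ncheck k) z"
proof (induction k)
  case 0
  have *: "dense p (\<lambda>q. \<exists>n. name n \<and> fmem q n z \<and> fempty q n)"
    using assms unfolding finductive_def by blast
  show ?case
    by (rule regular_dense_use[OF regular_fmem *]) (use fempty_unique fmem_cong_left in blast)
next
  case (Suc k)
  show ?case
  proof (cases "p \<in> elts P")
    case True
    then have *: "dense p (\<lambda>r. \<exists>m. name m \<and> fmem r m z \<and> fsucc r m (ncheck k))"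
      using assms Suc below_refl name_check unfolding finductive_def by blast
    show ?thesis
      by (rule regular_dense_use[OF regular_fmem *])
        (use fsucc_unique feq_refl fmem_cong_left in blast)
  \<comment> \<open>The inductive clause is applied at \<open>p\<close> itself. Outside
    \<open>P\<close> nothing lies below \<open>p\<close>, and membership holds vacuously.\<close>
  next
    case False
    then show ?thesis using below_carrier by (intro regularI[OF regular_fmem]) blast
  qed
qed

text \<open>A member of \<open>check P om\<close> is densely equal to some \<open>ncheck k\<close>,
  and every inductive name contains all of these.\<close>

lemma forces_omega: assumes "v w = check P om" shows "forces P le p v (fm_omega w)"
proof -
  have "fsub q (check P om) z" if "finductive q z" for q z
    unfolding fsub_def
  proof (intro allI impI)
    fix c q' assume q': "q' \<preceq> q" "fmem q' c (check P om)"
    show "fmem q' c z"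
    proof (rule regularI[OF regular_fmem])
      fix r assume "r \<preceq> q'"
      with q'(2) obtain r' k where r': "r' \<preceq> r" "feq r' c (ncheck k)" by (rule ncheck_omE)
      have "r' \<preceq> q" using r'(1) \<open>r \<preceq> q'\<close> q'(1) below_trans by blast
      then have "fmem r' (ncheck k) z" using finductive_ncheck[OF that] fmem_mono by blast
      then show "\<exists>r'. r' \<preceq> r \<and> fmem r' c z" using r' fmem_cong_left feq_sym by blast
    qed
  qed
  then show ?thesis
    unfolding fm_omega_def Let_def forces_And forces_Forall
    unfolding forces_Imp forces_inductive forces_sub using assms finductive_om by simp
qed

section \<open>Functions on a ground-model domain\<close>

text \<open>A name for the function on \<open>d\<close> whose values in the extension are given by
  the names \<open>h i\<close>; the map from arguments to names of values lives in the ground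
  model.\<close>

definition fnn :: "'v \<Rightarrow> ('v \<Rightarrow> 'v) \<Rightarrow> 'v" where
  "fnn d h = cname ((\<lambda>i. pairn (check P i) (h i)) ` elts d)"

lemma small_fnn: "small ((\<lambda>i. pairn (check P i) (h i)) ` elts d)"
  by (intro small_image small_elts)

lemma name_fnn: "(\<And>i. i \<in> elts d \<Longrightarrow> name (h i)) \<Longrightarrow> name (fnn d h)"
  unfolding fnn_def by (rule name_mkname[OF small_fnn]) (auto intro: name_pairn)

text \<open>Canonical names of distinct arguments are never forced equal, so only the pair for
  \<open>i\<close> itself can match.\<close>

lemma fmem_fnn:
  assumes "i \<in> elts d" shows "fmem p (pairn (check P i) y) (fnn d h) \<longleftrightarrow> feq p y (h i)"
proof
  assume "fmem p (pairn (check P i) y) (fnn d h)"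
  then have *: "dense p (\<lambda>q. \<exists>j\<in>elts d. feq q (check P i) (check P j) \<and> feq q y (h j))"
    unfolding fnn_def fmem_cname[OF small_fnn] by (simp add: feq_pairn_iff)
  show "feq p y (h i)"
    by (rule regular_dense_use[OF regular_feq *]) (use feq_check_eq below_carrier in blast)
next
  assume "feq p y (h i)"
  then show "fmem p (pairn (check P i) y) (fnn d h)"
    unfolding fnn_def using assms
    by (intro fmem_cnameI[OF small_fnn, of "pairn (check P i) (h i)"]) (auto simp: feq_pairn_iff feq_refl)
qed

lemma ffun_fnn:
  assumes "\<And>i. i \<in> elts d \<Longrightarrow> name (h i)" shows "ffun p (fnn d h) (check P d)"
  unfolding ffun_def
proof (intro conjI allI impI)
  fix z q assume "fmem q z (fnn d h)"
  then have "dense q (\<lambda>r. \<exists>i\<in>elts d. feq r z (pairn (check P i) (h i)))"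
    unfolding fnn_def fmem_cname[OF small_fnn] by simp
  then show "dense q (\<lambda>r. \<exists>x. name x \<and> fmem r x (check P d) \<and>
      dense r (\<lambda>r'. \<exists>y. name y \<and> feq r' z (pairn x y)))"
  proof (rule dense_weaken)
    fix r assume "\<exists>i\<in>elts d. feq r z (pairn (check P i) (h i))"
    then obtain i where i: "i \<in> elts d" "feq r z (pairn (check P i) (h i))" by blast
    then have "dense r (\<lambda>r'. \<exists>y. name y \<and> feq r' z (pairn (check P i) y))"
      using assms feq_mono by (intro dense_all) blast
    then show "\<exists>x. name x \<and> fmem r x (check P d) \<and>
      dense r (\<lambda>r'. \<exists>y. name y \<and> feq r' z (pairn x y))"
      using i(1) fmem_checkI feq_refl name_check by blast
  qed
next
  fix x q assume "fmem q x (check P d)"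
  then show "dense q (\<lambda>r. \<exists>y. name y \<and> fmem r (pairn x y) (fnn d h) \<and>
          (\<forall>y' r'. name y' \<longrightarrow> r' \<preceq> r \<longrightarrow> fmem r' (pairn x y') (fnn d h) \<longrightarrow> feq r' y' y))"
    unfolding fmem_check
  proof (rule dense_weaken)
    fix r assume "\<exists>i\<in>elts d. feq r x (check P i)"
    then obtain i where i: "i \<in> elts d" "feq r x (check P i)" by blast
    have *: "fmem r' (pairn x y) (fnn d h) \<longleftrightarrow> feq r' y (h i)" if "feq r' x (check P i)" for r' y
    proof -
      have "feq r' (pairn x y) (pairn (check P i) y)" using that by (simp add: feq_pairn_iff feq_refl)
      then show ?thesis using fmem_fnn[OF i(1)] fmem_cong[OF _ feq_refl] by blast
    qed
    then show "\<exists>y. name y \<and> fmem r (pairn x y) (fnn d h) \<and>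
          (\<forall>y' r'. name y' \<longrightarrow> r' \<preceq> r \<longrightarrow> fmem r' (pairn x y') (fnn d h) \<longrightarrow> feq r' y' y)"
      using assms[OF i(1)] i(2) feq_mono feq_refl by (intro exI[of _ "h i"]) simp
  qed
qed

section \<open>Finite sets of names\<close>

lemma small_finite: "finite A \<Longrightarrow> small A"
  by (induction rule: finite_induct) simp_all

text \<open>For each \<open>c\<close> in turn, pass to an extension satisfying \<open>Q c\<close> if
  there is one. By monotonicity earlier decisions survive the later extensions.\<close>

lemma decide_finite:
  assumes "finite C" and mono: "\<And>c p q. Q c p \<Longrightarrow> q \<preceq> p \<Longrightarrow> Q c q" and "p \<in> elts P"
  obtains q where "q \<preceq> p" "\<And>c. c \<in> C \<Longrightarrow> Q c q \<or> (\<forall>r. r \<preceq> q \<longrightarrow> \<not> Q c r)"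
proof -
  have "\<exists>q. q \<preceq> p \<and> (\<forall>c\<in>C. Q c q \<or> (\<forall>r. r \<preceq> q \<longrightarrow> \<not> Q c r))"
    using assms(1)
  proof (induction rule: finite_induct)
    case empty then show ?case using assms(3) below_refl by blast
  next
    case (insert x C)
    then obtain q where q: "q \<preceq> p" "\<And>c. c \<in> C \<Longrightarrow> Q c q \<or> (\<forall>r. r \<preceq> q \<longrightarrow> \<not> Q c r)" by blast
    obtain q' where q': "q' \<preceq> q" "Q x q' \<or> (\<forall>r. r \<preceq> q' \<longrightarrow> \<not> Q x r)"
      using below_refl'[OF q(1)] by blast
    have "Q c q' \<or> (\<forall>r. r \<preceq> q' \<longrightarrow> \<not> Q c r)" if "c \<in> C" for c
      using q(2)[OF that] q'(1) mono below_trans by meson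
    then show ?case using q'(1,2) below_trans[OF q'(1) q(1)] by blast
  qed
  then show thesis using that by blast
qed

text \<open>Once a condition decides which members of \<open>C\<close> enter the name, these form a
  finite list in the ground model, and an \<open>fnn\<close> name enumerates it. Such conditions are
  dense.\<close>

lemma forces_finite:
  assumes C: "finite C" "\<And>c. c \<in> C \<Longrightarrow> name c" and va: "v a = mkname C R"
  shows "forces P le p v (fm_finite a)"
proof (rule regularI[OF regular_forces])
  fix q assume "q \<preceq> p"
  \<comment> \<open>\<open>Q c q\<close> means that \<open>q\<close> already puts \<open>c\<close>
    into the name by lying below one of its attached conditions.\<close>
  define Q where "Q c q \<longleftrightarrow> (\<exists>s. R c s \<and> q \<preceq> s)" for c q
  have mono: "Q c q \<Longrightarrow> r \<preceq> q \<Longrightarrow> Q c r" for c q r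
    unfolding Q_def using below_trans by blast
  obtain r where r: "r \<preceq> q" "\<And>c. c \<in> C \<Longrightarrow> Q c r \<or> (\<forall>r'. r' \<preceq> r \<longrightarrow> \<not> Q c r')"
    using decide_finite[OF C(1), of Q q] mono \<open>q \<preceq> p\<close> below_carrier by metis
  have "finite {c \<in> C. Q c r}" using C(1) by simp
  then obtain k :: nat and h where h: "{c \<in> C. Q c r} = h ` {i. i < k}"
    using finite_imp_nat_seg_image_inj_on by metis
  define g where "g = fnn (nat_of k) (h \<circ> inv nat_of)"
  have inv: "inv nat_of (nat_of i :: 'v) = i" for i
    using inj_nat_of by (rule inv_f_f)
  have hC: "h i \<in> C" "Q (h i) r" if "i < k" for i
    using h that by auto
  have nm: "name ((h \<circ> inv nat_of) i)" if "i \<in> elts (nat_of k)" for i :: 'v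
    using that hC C(2) by (auto simp: elts_nat_of inv)
  have g: "name g" "ffun r g (check P (nat_of k))"
    unfolding g_def using nm by (auto intro: name_fnn ffun_fnn)
  have gi: "fmem r' (pairn (ncheck i) y) g \<longleftrightarrow> feq r' y (h i)" if "i < k" for r' i y
    unfolding g_def using that by (subst fmem_fnn) (auto simp: elts_nat_of inv)
  have mem: "fmem r' y (v a) \<longleftrightarrow> dense r' (\<lambda>r. \<exists>i. name i \<and> fmem r i (ncheck k) \<and> fmem r (pairn i y) g)"
    if r': "r' \<preceq> r" "name y" for r' y
  proof -
    have "fmem r' y (v a) \<longleftrightarrow> dense r' (\<lambda>q. \<exists>i<k. feq q y (h i))"
      unfolding va fmem_mkname[OF small_finite[OF C(1)]]
    proof (rule dense_cong)
      fix q assume q: "q \<preceq> r'"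
      \<comment> \<open>Since \<open>r\<close> has decided \<open>Q c\<close>, the answer is the
        same at every condition below \<open>r\<close>.\<close>
      have "Q c q \<longleftrightarrow> Q c r" if "c \<in> C" for c
        using r(2)[OF that] mono q r'(1) below_trans by blast
      then have "(\<exists>c\<in>C. Q c q \<and> feq q y c) \<longleftrightarrow> (\<exists>c\<in>{c\<in>C. Q c r}. feq q y c)" by blast
      also have "\<dots> \<longleftrightarrow> (\<exists>i<k. feq q y (h i))" unfolding h by auto
      finally show "(\<exists>c\<in>C. \<exists>r. q \<preceq> r \<and> R c r \<and> feq q y c) \<longleftrightarrow> (\<exists>i<k. feq q y (h i))"
        unfolding Q_def by blast
    qed
    also have "\<dots> \<longleftrightarrow> dense r' (\<lambda>r. \<exists>i. name i \<and> fmem r i (ncheck k) \<and> fmem r (pairn i y) g)"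
    proof
      assume "dense r' (\<lambda>q. \<exists>i<k. feq q y (h i))"
      then show "dense r' (\<lambda>r. \<exists>i. name i \<and> fmem r i (ncheck k) \<and> fmem r (pairn i y) g)"
      proof (rule dense_weaken)
        fix q assume "\<exists>i<k. feq q y (h i)"
        then obtain i where i: "i < k" "feq q y (h i)" by blast
        have "fmem q (ncheck i) (ncheck k)"
          by (rule fmem_checkI[OF _ feq_refl]) (use i(1) in \<open>simp add: elts_nat_of\<close>)
        then show "\<exists>i. name i \<and> fmem q i (ncheck k) \<and> fmem q (pairn i y) g"
          using i gi name_check by blast
      qed
    next
      assume *: "dense r' (\<lambda>r. \<exists>i. name i \<and> fmem r i (ncheck k) \<and> fmem r (pairn i y) g)"
      show "dense r' (\<lambda>q. \<exists>i<k. feq q y (h i))"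
      proof (rule denseI)
        fix q assume "q \<preceq> r'"
        then obtain q' i where q': "q' \<preceq> q" "fmem q' i (ncheck k)" "fmem q' (pairn i y) g"
          using * by (blast elim: denseE)
        then obtain q'' j where q'': "q'' \<preceq> q'" "j \<in> elts (nat_of k)" "feq q'' i (check P j)"
          using below_refl' fmem_checkE by metis
        then obtain l where l: "j = nat_of l" "l < k" by (auto simp: elts_nat_of)
        have "fmem q'' (pairn i y) g" using q' q''(1) fmem_mono by blast
        then have "fmem q'' (pairn (ncheck l) y) g"
          using q''(3) l feq_pairn_iff feq_refl fmem_cong_left by blast
        then show "\<exists>q'. q' \<preceq> q \<and> (\<exists>i<k. feq q' y (h i))"
          using gi l(2) q'(1) q''(1) below_trans by blast
      qed
    qed
    finally show ?thesis .
  qed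
  \<comment> \<open>Variables \<open>a + 1\<close>, \<open>a + 2\<close> and \<open>a + 3\<close>
    are those that \<open>fm_finite a\<close> uses for omega, the length and the
    enumeration.\<close>
  have fin: "forces P le r (v(a + 1 := check P om, a + 2 := ncheck k, a + 3 := g))
      (And (fm_fun (a + 3) (a + 2)) (Forall (a + 4) (Iff (Mem (a + 4) a)
         (BEx (a + 5) (a + 2) (fm_app (a + 3) (a + 5) (a + 4))))))"
    unfolding forces_And[of _ _ "fm_fun _ _"] forces_Forall forces_Iff
    using g(2) mem by (simp add: forces_fun forces_clauses(4-) forces_app del: forces.simps(3-) cong: conj_cong)
  have "forces P le r v (fm_finite a)"
    unfolding fm_finite_def Let_def
    apply (rule forces_ExI[OF name_check[of om]])
    apply (subst forces_And, rule conjI, rule forces_omega, simp)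
    apply (rule forces_ExI[OF name_check[of "nat_of k"]])
    apply (subst forces_And, rule conjI)
    subgoal by (simp add: fmem_ncheck_om)
    apply (rule forces_ExI[OF g(1)])
    apply (rule fin)
    done
  then show "\<exists>r. r \<preceq> q \<and> forces P le r v (fm_finite a)" using r(1) by blast
qed

end

section \<open>Closure points and Menger spaces in the ground model\<close>

text \<open>Unboundedness comes from closing off under \<open>c\<close> in countably many rounds;
  closure under chains holds because each point of the union already lies in one closed
  member.\<close>

lemma club_closure_points:
  fixes c :: "'a \<Rightarrow> 'a set"
  assumes "\<And>x. x \<in> A \<Longrightarrow> countable (c x)" "\<And>x. x \<in> A \<Longrightarrow> c x \<subseteq> A"
  shows "club_in A {M \<in> ctbl_subsets A. \<forall>x\<in>M. c x \<subseteq> M}"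
  unfolding club_in_def
proof (intro conjI ballI allI impI)
  fix x assume x: "x \<in> ctbl_subsets A"
  \<comment> \<open>Round \<open>n + 1\<close> adds the values of \<open>c\<close> at all points of
    round \<open>n\<close>; every round remains a countable subset of \<open>A\<close>.\<close>
  define N where "N n = ((\<lambda>B. B \<union> \<Union>(c ` B)) ^^ n) x" for n
  have N0: "N 0 = x" and NS: "N (Suc n) = N n \<union> \<Union>(c ` N n)" for n
    by (simp_all add: N_def)
  have N: "N n \<subseteq> A \<and> countable (N n)" for n
  proof (induction n)
    case 0 show ?case using x by (simp add: N0 ctbl_subsets_def)
  next
    case (Suc n) then show ?case using assms by (simp add: NS) blast
  qed
  have "c y \<subseteq> (\<Union>n. N n)" if "y \<in> N n" for y n
    using that NS[of n] by blast
  moreover have "x \<subseteq> (\<Union>n. N n)" using N0 by blast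
  moreover have "infinite (\<Union>n. N n)"
    using \<open>x \<subseteq> (\<Union>n. N n)\<close> x infinite_super unfolding ctbl_subsets_def by blast
  ultimately show "\<exists>M\<in>{M \<in> ctbl_subsets A. \<forall>x\<in>M. c x \<subseteq> M}. x \<subseteq> M"
    using N[THEN conjunct1] N[THEN conjunct2]
    by (intro bexI[of _ "\<Union>n. N n"]) (auto simp: ctbl_subsets_def subset_iff)
next
  fix f :: "nat \<Rightarrow> 'a set"
  assume f: "incseq f \<and> range f \<subseteq> {M \<in> ctbl_subsets A. \<forall>x\<in>M. c x \<subseteq> M}"
  then have fn: "f n \<in> ctbl_subsets A" "\<And>x. x \<in> f n \<Longrightarrow> c x \<subseteq> f n" for n
    by auto
  have "infinite (\<Union>n. f n)"
    using fn(1)[of 0] infinite_super[of "f 0"] unfolding ctbl_subsets_def by blast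
  then show "(\<Union>n. f n) \<in> {M \<in> ctbl_subsets A. \<forall>x\<in>M. c x \<subseteq> M}"
    using fn(1) fn(2)[THEN subsetD] unfolding ctbl_subsets_def by (auto simp: subset_iff) blast+
qed blast

text \<open>The transitive closure of an element of \<open>x\<close> is contained in that of the
  pair. Applied to \<open>pair P le\<close>, this puts all conditions into
  \<open>H \<theta>\<close>, where the club of closed sets is formed.\<close>

lemma elts_subset_H: assumes "pair x y \<in> H \<theta>" shows "elts x \<subseteq> H \<theta>"
proof
  fix z assume z: "z \<in> elts x"
  have m: "(z, x) \<in> mem_rel" "(x, set_of {x, y}) \<in> mem_rel" "(set_of {x, y}, pair x y) \<in> mem_rel"
    using z by (auto simp: mem_rel_def elts_set_of elts_pair)
  have "(z, pair x y) \<in> mem_rel\<^sup>+"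
    using r_into_trancl[OF m(1)] m(2,3) by (blast intro: trancl_into_trancl)
  then have "(w, pair x y) \<in> mem_rel\<^sup>+" if "(w, z) \<in> mem_rel\<^sup>+" for w
    using that by (rule trancl_trans[rotated])
  then have "trcl z \<subseteq> trcl (pair x y)" unfolding trcl_def by blast
  then have "|trcl z| \<le>o |trcl (pair x y)|" by (rule card_of_mono1)
  moreover have "|trcl (pair x y)| <o |elts \<theta>|" using assms by (simp add: H_def)
  ultimately show "z \<in> H \<theta>" unfolding H_def by (intro CollectI) (rule ordLeq_ordLess_trans)
qed

text \<open>Menger spaces are Lindelof: apply the selection principle to the constant sequence of
  covers.\<close>

lemma Menger_countable_subcover:
  assumes "Menger_space T" "\<And>S. S \<in> U \<Longrightarrow> openin T S" "\<Union>U = topspace T"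
  obtains V where "countable V" "V \<subseteq> U" "\<Union>V = topspace T"
proof -
  obtain F :: "nat \<Rightarrow> _" where F: "\<And>n. finite (F n) \<and> F n \<subseteq> U" "(\<Union>n. \<Union>(F n)) = topspace T"
    using assms(1)[unfolded Menger_space_def, rule_format, of "\<lambda>_. U"] assms(2,3) by blast
  show thesis
  proof (rule that[of "\<Union>n. F n"])
    show "countable (\<Union>n. F n)" using F(1) by (auto intro: countable_finite)
  qed (use F(1) in blast, subst F(2)[symmetric], blast)
qed

context forcing_poset begin

section \<open>A name for the generated topology\<close>

text \<open>The standard nice name of a subset of \<open>X\<close>. All such names belong to one
  ground-model set, which allows a topology to be named.\<close>

definition nice_name :: "'v \<Rightarrow> 'v \<Rightarrow> 'v" where
  "nice_name X a = mkname (check P ` elts X) (\<lambda>c r. fmem r c a)"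

lemma nice_name_VPow: "nice_name X a \<in> elts (VPow (check P X))"
  unfolding check_eq[of X] by (auto simp: nice_name_def elts_mkname)

lemma name_VPow_check: "u \<in> elts (VPow (check P X)) \<Longrightarrow> name u"
  unfolding check_eq[of X] by (rule is_name.intros) (force simp: elts_mkname)

text \<open>A condition identifying a member of \<open>a\<close> with some \<open>check P y\<close>
  itself forces \<open>check P y\<close> into \<open>a\<close>, so it is attached to
  \<open>check P y\<close> in the nice name.\<close>

lemma feq_nice_name:
  assumes "fsub p a (check P X)" "name a" shows "feq p a (nice_name X a)"
proof -
  have "fmem q c a \<longleftrightarrow> fmem q c (nice_name X a)" if q: "q \<preceq> p" "name c" for q c
  proof
    assume c: "fmem q c a"
    then have "fmem q c (check P X)" using assms(1) q by (blast intro: fsubD)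
    then show "fmem q c (nice_name X a)"
      unfolding nice_name_def fmem_mkname[OF small_check] fmem_check
    proof (rule dense_weaken)
      fix r assume r: "r \<preceq> q" "\<exists>y\<in>elts X. feq r c (check P y)"
      then obtain y where y: "y \<in> elts X" "feq r c (check P y)" by blast
      then have "fmem r (check P y) a" using c r(1) fmem_mono fmem_cong_left by blast
      then show "\<exists>d\<in>check P ` elts X. \<exists>s. r \<preceq> s \<and> fmem s d a \<and> feq r c d"
        using y below_refl'[OF r(1)] by blast
    qed
  next
    assume "fmem q c (nice_name X a)"
    then have *: "dense q (\<lambda>r. \<exists>d\<in>check P ` elts X. \<exists>s. r \<preceq> s \<and> fmem s d a \<and> feq r c d)"
      unfolding nice_name_def fmem_mkname[OF small_check] .
    show "fmem q c a"
      by (rule regular_dense_use[OF regular_fmem *])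
        (use fmem_mono fmem_cong_left feq_sym in blast)
  qed
  moreover have "name (nice_name X a)" using nice_name_VPow name_VPow_check by blast
  ultimately show ?thesis using assms(2) by (simp add: feq_ext)
qed

text \<open>The forcing clause of the right-hand side of
  \<open>fm_topology_with_basis\<close>.\<close>

definition fgen :: "'v \<Rightarrow> 'v \<Rightarrow> 'v \<Rightarrow> bool" where
  "fgen b p U \<longleftrightarrow> dense p (\<lambda>q. \<exists>S. name S \<and> fsub q S b \<and> fUnion q U S)"

text \<open>Members range over the subsets of \<open>check P X\<close>, so that a set of candidates
  suffices; nice names ensure that no open set of the extension is lost.\<close>

definition topn :: "'v \<Rightarrow> 'v \<Rightarrow> 'v" where
  "topn X \<tau> = mkname (elts (VPow (check P X))) (\<lambda>u r. fgen (check P \<tau>) r u)"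

lemma name_topn: "name (topn X \<tau>)"
  unfolding topn_def by (rule name_mkname) (simp_all add: name_VPow_check del: elts_VPow)

lemma fgen_mono: "fgen b p U \<Longrightarrow> q \<preceq> p \<Longrightarrow> fgen b q U"
  unfolding fgen_def by (rule dense_mono)

lemma fgen_cong: assumes "feq p U U'" "fgen b p U" shows "fgen b p U'"
  using assms(2) unfolding fgen_def
proof (rule dense_weaken)
  fix q assume "q \<preceq> p" "\<exists>S. name S \<and> fsub q S b \<and> fUnion q U S"
  moreover from \<open>q \<preceq> p\<close> have "fUnion q U S \<Longrightarrow> fUnion q U' S" for S
    unfolding fUnion_def
    using fmem_cong[OF feq_refl feq_mono[OF assms(1)]] below_trans by simp
  ultimately show "\<exists>S. name S \<and> fsub q S b \<and> fUnion q U' S" by blast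
qed

lemma fmem_topn:
  assumes "\<Union>(elts ` elts \<tau>) \<subseteq> elts X" "name U"
  shows "fmem p U (topn X \<tau>) \<longleftrightarrow> fgen (check P \<tau>) p U"
proof
  assume "fmem p U (topn X \<tau>)"
  then have "dense p (\<lambda>q. \<exists>u\<in>elts (VPow (check P X)). \<exists>r. q \<preceq> r \<and> fgen (check P \<tau>) r u \<and> feq q U u)"
    unfolding topn_def fmem_mkname[OF small_elts] .
  then have "dense p (\<lambda>q. fgen (check P \<tau>) q U)"
    by (rule dense_weaken) (meson fgen_cong fgen_mono feq_sym)
  then show "fgen (check P \<tau>) p U" unfolding fgen_def dense_dense .
next
  assume gen: "fgen (check P \<tau>) p U"
  show "fmem p U (topn X \<tau>)"
  proof (rule regularI[OF regular_fmem])
    fix q assume "q \<preceq> p"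
    then obtain r S where r: "r \<preceq> q" and S: "name S" "fsub r S (check P \<tau>)" "fUnion r U S"
      using gen unfolding fgen_def by (blast elim: denseE)
    \<comment> \<open>A point of \<open>U\<close> lies in a member of \<open>S\<close>, which is
      densely some \<open>V\<close> in \<open>\<tau>\<close>, and \<open>V\<close> is a subset of
      \<open>X\<close>. This makes \<open>U\<close> eligible for a nice name.\<close>
    have "fsub r U (check P X)"
      unfolding fsub_def
    proof (intro allI impI)
      fix c r' assume c: "name c" "r' \<preceq> r" "fmem r' c U"
      show "fmem r' c (check P X)"
      proof (rule regularI[OF regular_fmem])
        fix t assume t: "t \<preceq> r'"
        obtain t1 y where y: "t1 \<preceq> t" "name y" "fmem t1 y S" "fmem t1 c y"
          using fUnionE[OF fUnion_mono[OF S(3) c(2)] c(1,3) t] .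
        have "t1 \<preceq> r" using y(1) t c(2) below_trans by blast
        then have "fmem t1 y (check P \<tau>)" using fsubD[OF S(2) y(2) _ y(3)] by blast
        then obtain t2 V where V: "t2 \<preceq> t1" "V \<in> elts \<tau>" "feq t2 y (check P V)"
          using below_refl'[OF y(1)] by (rule fmem_checkE)
        then have "fmem t2 c (check P V)" using y(4) fmem_mono fmem_cong_right by blast
        then obtain t3 x where x: "t3 \<preceq> t2" "x \<in> elts V" "feq t3 c (check P x)"
          using below_refl'[OF V(1)] by (rule fmem_checkE)
        then have "fmem t3 c (check P X)" using V(2) assms(1) by (intro fmem_checkI[of x]) auto
        then show "\<exists>r. r \<preceq> t \<and> fmem r c (check P X)"
          using x(1) V(1) y(1) below_trans by blast
      qed
    qed
    then have eq: "feq r U (nice_name X U)" using assms(2) by (rule feq_nice_name)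
    have "fgen (check P \<tau>) r U" using gen \<open>q \<preceq> p\<close> r fgen_mono by blast
    then have "fgen (check P \<tau>) r (nice_name X U)" using eq fgen_cong by blast
    then have "fmem r U (topn X \<tau>)"
      unfolding topn_def fmem_mkname[OF small_elts] using eq nice_name_VPow[of X U]
      by (intro dense_all) (meson feq_mono)
    then show "\<exists>r. r \<preceq> q \<and> fmem r U (topn X \<tau>)" using r by blast
  qed
qed

lemma forces_topology_with_basis:
  assumes "\<Union>(elts ` elts \<tau>) \<subseteq> elts X" "v T = topn X \<tau>" "v b = check P \<tau>"
  shows "forces P le p v (fm_topology_with_basis T b)"
  unfolding fm_topology_with_basis_def Let_def forces_Forall forces_Iff
  using assms
  by (simp add: forces_Ex forces_And forces_sub forces_Union fmem_topn fgen_def del: forces.simps(3-))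

section \<open>Forcing the selection principle\<close>

lemma ffun_unique:
  assumes "ffun p f d" "q \<preceq> p" "fmem q n d" "fmem q (pairn n u) f" "fmem q (pairn n w) f"
    and "name n" "name u" "name w"
  shows "feq q u w"
proof -
  have *: "dense q (\<lambda>r. \<exists>y. name y \<and> fmem r (pairn n y) f \<and>
          (\<forall>y' r'. name y' \<longrightarrow> r' \<preceq> r \<longrightarrow> fmem r' (pairn n y') f \<longrightarrow> feq r' y' y))"
    using assms unfolding ffun_def by blast
  show ?thesis
  proof (rule regular_dense_use[OF regular_feq *])
    fix r assume r: "r \<preceq> q" "\<exists>y. name y \<and> fmem r (pairn n y) f \<and>
          (\<forall>y' r'. name y' \<longrightarrow> r' \<preceq> r \<longrightarrow> fmem r' (pairn n y') f \<longrightarrow> feq r' y' y)"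
    then obtain y where "\<And>y'. name y' \<Longrightarrow> fmem r (pairn n y') f \<Longrightarrow> feq r y' y"
      using below_refl' by blast
    then have "feq r u y" "feq r w y" using assms(4,5,7,8) r(1) fmem_mono by blast+
    then show "feq r u w" by (meson feq_sym feq_trans)
  qed
qed

section \<open>Forced covers and their ground-model approximations\<close>

text \<open>The premise of \<open>fm_selection\<close> on the sequence, as it is forced at
  \<open>p\<close>; the successive conditions \<open>q\<close> and \<open>r\<close> come from its
  nested implications.\<close>

definition cover_seq :: "'v \<Rightarrow> 'v \<Rightarrow> 'v \<Rightarrow> 'v \<Rightarrow> bool" where
  "cover_seq X \<tau> p s \<longleftrightarrow> name s \<and> ffun p s (check P om) \<and>
     (\<forall>n q. name n \<longrightarrow> q \<preceq> p \<longrightarrow> fmem q n (check P om) \<longrightarrow>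
        (\<forall>u r. name u \<longrightarrow> r \<preceq> q \<longrightarrow> fmem r (pairn n u) s \<longrightarrow>
           fsub r u (topn X \<tau>) \<and> fUnion r (check P X) u))"

text \<open>\<open>V\<close> approximates \<open>y\<close> from the ground model: \<open>r\<close>
  puts \<open>y\<close> into the \<open>n\<close>-th cover and \<open>V\<close> inside
  \<open>y\<close>. The name \<open>y\<close> is retained because the extension must select actual
  members of the covers.\<close>

definition selects :: "'v \<Rightarrow> 'v \<Rightarrow> nat \<Rightarrow> 'v \<Rightarrow> 'v \<Rightarrow> bool" where
  "selects s r n y V \<longleftrightarrow> name y \<and> fsub r (check P V) y \<and>
     (\<exists>u. name u \<and> fmem r (pairn (ncheck n) u) s \<and> fmem r y u)"

text \<open>Successive extensions fix the cover \<open>u\<close> at \<open>n\<close>, a member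
  \<open>y\<close> of it containing \<open>x\<close>, a family \<open>S\<close> of basic sets with
  union \<open>y\<close>, and a member of \<open>S\<close> containing \<open>x\<close>, which is
  finally identified with some ground-model \<open>V\<close>.\<close>

lemma selects_cover:
  assumes top: "\<Union>(elts ` elts \<tau>) \<subseteq> elts X" and s: "cover_seq X \<tau> p s" and q: "q \<preceq> p" and x: "x \<in> elts X"
  shows "\<exists>r y V. r \<preceq> q \<and> V \<in> elts \<tau> \<and> selects s r n y V \<and> x \<in> elts V"
proof -
  have "dense q (\<lambda>r. \<exists>y. name y \<and> fmem r (pairn (ncheck n) y) s \<and>
          (\<forall>y' r'. name y' \<longrightarrow> r' \<preceq> r \<longrightarrow> fmem r' (pairn (ncheck n) y') s \<longrightarrow> feq r' y' y))"
    using s q fmem_ncheck_om name_check unfolding cover_seq_def ffun_def by blast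
  then obtain r1 u where u: "r1 \<preceq> q" "name u" "fmem r1 (pairn (ncheck n) u) s"
    using below_refl'[OF q] by (blast elim: denseE)
  have sub: "fsub r1 u (topn X \<tau>)" and un: "fUnion r1 (check P X) u"
    using s q u fmem_ncheck_om[of _ n] name_check unfolding cover_seq_def by blast+
  have xX: "fmem r1 (check P x) (check P X)" using x by (rule fmem_checkI) (rule feq_refl)
  obtain r2 y where y: "r2 \<preceq> r1" "name y" "fmem r2 y u" "fmem r2 (check P x) y"
    using fUnionE[OF un name_check xX below_refl'[OF u(1)]] .
  have "fmem r2 y (topn X \<tau>)" using fsubD[OF sub y(2,1,3)] .
  then have "fgen (check P \<tau>) r2 y" using fmem_topn[OF top y(2)] by blast
  then obtain r3 S where S: "r3 \<preceq> r2" "name S" "fsub r3 S (check P \<tau>)" "fUnion r3 y S"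
    unfolding fgen_def using below_refl'[OF y(1)] by (blast elim: denseE)
  obtain r4 z where z: "r4 \<preceq> r3" "name z" "fmem r4 z S" "fmem r4 (check P x) z"
    using fUnionE[OF S(4) name_check fmem_mono[OF y(4) S(1)] below_refl'[OF S(1)]] .
  have "fmem r4 z (check P \<tau>)" using fsubD[OF S(3) z(2,1,3)] .
  then obtain r5 V where V: "r5 \<preceq> r4" "V \<in> elts \<tau>" "feq r5 z (check P V)"
    using below_refl'[OF z(1)] by (rule fmem_checkE)
  have "fmem r5 (check P x) (check P V)"
    using z(4) V(1,3) fmem_mono fmem_cong_right by blast
  \<comment> \<open>Membership between canonical names is absolute, so the forced statement becomes
    a real one.\<close>
  then have "x \<in> elts V" using V(1) below_carrier fmem_check_mem by blast
  moreover have "fsub r5 (check P V) y"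
    unfolding fsub_def
  proof (intro allI impI)
    fix c r assume c: "name c" "r \<preceq> r5" "fmem r c (check P V)"
    then have "fmem r c z" using V(3) feq_mono feq_sym fmem_cong_right by blast
    moreover have "r \<preceq> r4" using c(2) V(1) by (rule below_trans)
    moreover have "fmem r z S" using z(3) \<open>r \<preceq> r4\<close> by (rule fmem_mono)
    moreover have "r \<preceq> r3" using \<open>r \<preceq> r4\<close> z(1) by (rule below_trans)
    ultimately show "fmem r c y" using fUnionI[OF S(4) c(1) _ z(2)] by blast
  qed
  moreover have "r5 \<preceq> r2" using V(1) z(1) S(1) below_trans by blast
  moreover have "r5 \<preceq> r1" using \<open>r5 \<preceq> r2\<close> y(1) by (rule below_trans)
  ultimately have "selects s r5 n y V"
    unfolding selects_def using y(2) u(2) fmem_mono[OF u(3)] fmem_mono[OF y(3)] by blast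
  moreover have "r5 \<preceq> q" using \<open>r5 \<preceq> r1\<close> u(1) by (rule below_trans)
  ultimately show ?thesis using V(2) \<open>x \<in> elts V\<close> by blast
qed

text \<open>Extending \<open>r0\<close> makes \<open>selects_cover\<close> available below
  \<open>r\<close>, so the sets \<open>V\<close> approximated there cover \<open>X\<close>. The
  countable subcover is lifted to a countable set of triples that records the witnessing conditions
  and names.\<close>

lemma countable_selectors:
  assumes top: "is_top_space X \<tau>" and M: "Menger_space (space_of \<tau>)" and s: "cover_seq X \<tau> p s"
    and r: "r0 \<preceq> r" "r0 \<preceq> p"
  shows "\<exists>D. countable D \<and>
    (\<forall>(t, y, V)\<in>D. t \<preceq> r \<and> V \<in> elts \<tau> \<and> selects s t n y V) \<and>
    (\<Union>(t, y, V)\<in>D. elts V) = elts X"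
proof -
  define A where "A = {(t, y, V). t \<preceq> r \<and> V \<in> elts \<tau> \<and> selects s t n y V}"
  have tX: "\<Union>(elts ` elts \<tau>) = elts X" using top unfolding is_top_space_def by blast
  have "\<exists>(t, y, V)\<in>A. x \<in> elts V" if "x \<in> elts X" for x
    using selects_cover[OF _ s r(2) that, of n] tX below_trans[OF _ r(1)] unfolding A_def by blast
  moreover have AX: "elts V \<subseteq> elts X" "V \<in> elts \<tau>" if "(t, y, V) \<in> A" for t y V
    using that tX unfolding A_def by auto
  ultimately have un: "\<Union>((\<lambda>(t, y, V). elts V) ` A) = topspace (space_of \<tau>)"
    unfolding openin_space_of(2)[OF top] by fast
  have op: "openin (space_of \<tau>) S" if "S \<in> (\<lambda>(t, y, V). elts V) ` A" for S
    using that AX(2) unfolding openin_space_of(1)[OF top] by auto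
  obtain W where W: "countable W" "W \<subseteq> (\<lambda>(t, y, V). elts V) ` A" "\<Union>W = topspace (space_of \<tau>)"
    by (rule Menger_countable_subcover[OF M op un])
  then obtain D where "countable D" "D \<subseteq> A" "W = (\<lambda>(t, y, V). elts V) ` D"
    using countable_subset_image[of W "\<lambda>(t, y, V). elts V" A] by auto
  moreover from this have "(\<Union>(t, y, V)\<in>D. elts V) = elts X"
    using W(3) unfolding openin_space_of(2)[OF top] by (simp add: split_beta)
  ultimately show ?thesis unfolding A_def by blast
qed

section \<open>Finite selections in the ground model\<close>

text \<open>The choice from the \<open>n\<close>-th cover collects those \<open>y\<close> whose
  witness \<open>t\<close> enters the generic filter. The bound \<open>m \<le> n\<close> keeps it
  finite, while every \<open>m\<close> is still treated at all later stages.\<close>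

definition selector_name :: "(nat \<Rightarrow> nat \<Rightarrow> ('v \<times> 'v \<times> 'v) set) \<Rightarrow> nat \<Rightarrow> 'v" where
  "selector_name D n = mkname {y. \<exists>m\<le>n. \<exists>t V. (t, y, V) \<in> D m n} (\<lambda>y t. \<exists>m\<le>n. \<exists>V. (t, y, V) \<in> D m n)"

text \<open>The consequence of stationarity that the forcing argument uses: \<open>c\<close> will
  map a condition to its countably many witnesses.\<close>

definition strongly_proper_often :: "'v \<Rightarrow> bool" where
  "strongly_proper_often p \<longleftrightarrow> (\<forall>c. (\<forall>r\<in>elts P. countable (c r) \<and> c r \<subseteq> elts P) \<longrightarrow>
     (\<exists>N. countable N \<and> p \<in> N \<and> (\<forall>r\<in>N \<inter> elts P. c r \<subseteq> N) \<and> strongly_proper_for P le N))"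

text \<open>The last property says that, for each \<open>x\<close>, the witnesses \<open>t\<close>
  of triples covering \<open>x\<close> are predense below \<open>p1\<close>. Residues reduce this to
  conditions in \<open>N\<close>, which can be enumerated and handled one by one.\<close>

lemma generic_selection:
  assumes top: "is_top_space X \<tau>" and M: "Menger_space (space_of \<tau>)" and s: "cover_seq X \<tau> p s"
    and p: "p \<in> elts P"
    and models: "strongly_proper_often p"
  obtains p1 D where "p1 \<preceq> p" "\<And>m n. finite (D m n)"
    "\<And>m n t y V. (t, y, V) \<in> D m n \<Longrightarrow> V \<in> elts \<tau> \<and> selects s t n y V"
    "\<And>q x. q \<preceq> p1 \<Longrightarrow> x \<in> elts X \<Longrightarrow>
      \<exists>r m n t y V. m \<le> n \<and> (t, y, V) \<in> D m n \<and> x \<in> elts V \<and> r \<preceq> t \<and> r \<preceq> q"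
proof -
  \<comment> \<open>A condition \<open>r\<close> incompatible with \<open>p\<close> need not yield a
    cover and receives the empty set; this keeps \<open>D\<close> total.\<close>
  define Q where "Q r n D \<longleftrightarrow> countable D \<and>
      (\<forall>(t, y, V)\<in>D. t \<preceq> r \<and> V \<in> elts \<tau> \<and> selects s t n y V) \<and>
      (compatible P le r p \<longrightarrow> (\<Union>(t, y, V)\<in>D. elts V) = elts X)" for r n D
  have "\<exists>D. Q r n D" for r n
  proof (cases "compatible P le r p")
    case True
    then obtain r0 where r0: "r0 \<preceq> r" "r0 \<preceq> p" unfolding compatible_def by blast
    show ?thesis using countable_selectors[OF top M s r0, of n] unfolding Q_def by blast
  next
    case False then show ?thesis unfolding Q_def by (intro exI[of _ "{}"]) simp
  qed
  then obtain D where "\<And>r n. Q r n (D r n)" by metis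
  then have D: "countable (D r n)"
      "(t, y, V) \<in> D r n \<Longrightarrow> t \<preceq> r \<and> V \<in> elts \<tau> \<and> selects s t n y V"
      "compatible P le r p \<Longrightarrow> (\<Union>(t, y, V)\<in>D r n. elts V) = elts X" for r n t y V
    unfolding Q_def by blast+
  \<comment> \<open>The closure map sends \<open>r\<close> to the witnesses of its triples for all
    \<open>n\<close>.\<close>
  have c: "countable (\<Union>n. fst ` D r n) \<and> (\<Union>n. fst ` D r n) \<subseteq> elts P" for r
  proof
    have "t \<in> elts P" if "(t, y, V) \<in> D r n" for t y V n
      using D(2)[OF that] below_carrier(1) by blast
    then show "(\<Union>n. fst ` D r n) \<subseteq> elts P" by auto
  qed (simp add: D(1))
  obtain N where N: "countable N" "p \<in> N" "\<And>r. r \<in> N \<inter> elts P \<Longrightarrow> (\<Union>n. fst ` D r n) \<subseteq> N"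
    and sp: "strongly_proper_for P le N"
    using models[unfolded strongly_proper_often_def, rule_format, of "\<lambda>r. \<Union>n. fst ` D r n", OF c]
    by (elim exE conjE) (rule that, simp_all)
  obtain p1 where p1: "p1 \<preceq> p" and gen: "strongly_generic P le N p1"
    using sp N(2) p unfolding strongly_proper_for_def by blast
  \<comment> \<open>The enumeration is total because \<open>N \<inter> elts P\<close> contains
    \<open>p\<close>; repetitions are harmless.\<close>
  define rr where "rr = from_nat_into (N \<inter> elts P)"
  have rr: "range rr = N \<inter> elts P"
    unfolding rr_def using N(1,2) p by (intro range_from_nat_into) auto
  have "\<exists>F. (\<forall>n. finite (F n) \<and> F n \<subseteq> D (rr m) n) \<and>
      (compatible P le (rr m) p \<longrightarrow> (\<forall>x\<in>elts X. \<exists>n\<ge>m. \<exists>t y V. (t, y, V) \<in> F n \<and> x \<in> elts V))" for m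
  proof (cases "compatible P le (rr m) p")
    case True
    \<comment> \<open>The covers are shifted by \<open>m\<close>, so that the selections for
      \<open>rr m\<close> made at stages \<open>n \<ge> m\<close> alone already cover
      \<open>X\<close>.\<close>
    define U where "U k = (\<lambda>(t, y, V). elts V) ` D (rr m) (m + k)" for k
    have "V \<in> elts \<tau>" if "(t, y, V) \<in> D r n" for r n t y V
      using D(2)[OF that] by blast
    then have "\<forall>S\<in>U k. openin (space_of \<tau>) S" for k
      unfolding openin_space_of(1)[OF top] U_def by auto
    moreover have "\<Union>(U k) = topspace (space_of \<tau>)" for k
      using D(3)[OF True, of "m + k"] unfolding openin_space_of(2)[OF top] U_def by simp
    ultimately have "\<exists>G. (\<forall>k. finite (G k) \<and> G k \<subseteq> U k) \<and> (\<Union>k. \<Union>(G k)) = topspace (space_of \<tau>)"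
      using M unfolding Menger_space_def by simp
    then obtain G where G: "\<And>k. finite (G k) \<and> G k \<subseteq> U k" "(\<Union>k. \<Union>(G k)) = elts X"
      unfolding openin_space_of(2)[OF top] by blast
    have "\<exists>E. finite E \<and> E \<subseteq> D (rr m) (m + k) \<and> G k = (\<lambda>(t, y, V). elts V) ` E" for k
      using G(1)[of k] unfolding U_def by (meson finite_subset_image)
    then obtain E where E: "\<And>k. finite (E k)" "\<And>k. E k \<subseteq> D (rr m) (m + k)"
        "\<And>k. G k = (\<lambda>(t, y, V). elts V) ` E k"
      by metis
    \<comment> \<open>This undoes the shift; before stage \<open>m\<close> nothing is selected for
      \<open>rr m\<close>.\<close>
    define F where "F n = (if m \<le> n then E (n - m) else {})" for n
    have "F n \<subseteq> D (rr m) n" for n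
      using E(2)[of "n - m"] by (cases "m \<le> n") (simp_all add: F_def)
    moreover have "\<exists>n\<ge>m. \<exists>t y V. (t, y, V) \<in> F n \<and> x \<in> elts V" if x: "x \<in> elts X" for x
    proof -
      have "x \<in> (\<Union>k. \<Union>(G k))" using x unfolding G(2) .
      then obtain k S where "S \<in> G k" "x \<in> S" by blast
      then obtain t y V where "(t, y, V) \<in> E k" "x \<in> elts V" unfolding E(3) by auto
      then have "(t, y, V) \<in> F (m + k)" by (simp add: F_def)
      then show ?thesis using \<open>x \<in> elts V\<close> le_add1 by blast
    qed
    moreover have "finite (F n)" for n using E(1) by (simp add: F_def)
    ultimately show ?thesis by (intro exI[of _ F]) blast
  next
    case False then show ?thesis by (intro exI[of _ "\<lambda>_. {}"]) simp
  qed
  then obtain F where F: "\<And>m n. finite (F m n)" "\<And>m n. F m n \<subseteq> D (rr m) n"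
      "\<And>m x. compatible P le (rr m) p \<Longrightarrow> x \<in> elts X \<Longrightarrow> \<exists>n\<ge>m. \<exists>t y V. (t, y, V) \<in> F m n \<and> x \<in> elts V"
    by metis
  have "\<exists>r m n t y V. m \<le> n \<and> (t, y, V) \<in> F m n \<and> x \<in> elts V \<and> r \<preceq> t \<and> r \<preceq> q"
    if q: "q \<preceq> p1" and x: "x \<in> elts X" for q x
  proof -
    obtain r where "residue P le N q r"
      using gen q below_carrier(1) unfolding strongly_generic_def by blast
    then have r: "r \<in> N \<inter> elts P" "\<And>t. t \<in> N \<inter> elts P \<Longrightarrow> t \<preceq> r \<Longrightarrow> compatible P le t q"
      unfolding residue_def by blast+
    \<comment> \<open>The residue is an extension of itself, hence compatible with \<open>q\<close>
      and so with \<open>p\<close>; thus the selections for \<open>r\<close> do cover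
      \<open>X\<close>.\<close>
    have "compatible P le r q" using r(2)[OF r(1)] r(1) below_refl by blast
    then have "compatible P le r p"
      using below_trans[OF q p1] below_trans[of _ q p] unfolding compatible_def by blast
    moreover obtain m where m: "r = rr m" using r(1) unfolding rr[symmetric] by blast
    ultimately obtain n t y V where V: "n \<ge> m" "(t, y, V) \<in> F m n" "x \<in> elts V"
      using F(3) x by blast
    then have tD: "(t, y, V) \<in> D r n" using F(2) m by blast
    then have "t \<preceq> r" using D(2) by blast
    \<comment> \<open>Closure of \<open>N\<close> under witnesses puts \<open>t\<close> into
      \<open>N\<close>, so the residue property applies to \<open>t\<close>.\<close>
    moreover have "t \<in> N \<inter> elts P" using N(3)[OF r(1)] tD below_carrier(1)[OF \<open>t \<preceq> r\<close>] by force
    ultimately show ?thesis using r(2) V unfolding compatible_def by blast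
  qed
  moreover have "V \<in> elts \<tau> \<and> selects s t n y V" if "(t, y, V) \<in> F m n" for m n t y V
    using D(2)[of t y V "rr m" n] F(2)[of m n] that by blast
  ultimately show thesis using p1 F(1) by (intro that[of p1 F])
qed

section \<open>The selecting function in the extension\<close>

lemma finite_selector_names:
  fixes D :: "nat \<Rightarrow> nat \<Rightarrow> ('v \<times> 'v \<times> 'v) set"
  assumes "\<And>m. finite (D m n)" shows "finite {y. \<exists>m\<le>n. \<exists>t V. (t, y, V) \<in> D m n}"
proof (rule finite_subset)
  show "{y. \<exists>m\<le>n. \<exists>t V. (t, y, V) \<in> D m n} \<subseteq> (fst \<circ> snd) ` (\<Union>m\<le>n. D m n)"
    by force
  show "finite ((fst \<circ> snd) ` (\<Union>m\<le>n. D m n))"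
    by (intro finite_imageI finite_UN_I finite_atMost assms)
qed

lemma fmem_selector_name:
  assumes "\<And>m. finite (D m n)"
  shows "fmem q c (selector_name D n) \<longleftrightarrow>
    dense q (\<lambda>r. \<exists>m t y V. m \<le> n \<and> (t, y, V) \<in> D m n \<and> r \<preceq> t \<and> feq r c y)"
  unfolding selector_name_def fmem_mkname[OF small_finite[OF finite_selector_names[where D = D and n = n, OF assms]]]
  by (rule dense_cong) blast

text \<open>The function \<open>f\<close> takes the value \<open>selector_name D n\<close> at
  \<open>n\<close>. Uniqueness of the values of \<open>s\<close> places the selected names in the
  right cover, and predensity of the witnesses gives the covering of \<open>X\<close>.\<close>

lemma forces_fm_selection:
  assumes top: "is_top_space X \<tau>" and M: "Menger_space (space_of \<tau>)"
    and v: "v 0 = check P X" "v 2 = topn X \<tau>" "v 3 = check P om"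
    and models: "\<And>p. p \<in> elts P \<Longrightarrow> strongly_proper_often p"
  shows "forces P le p0 v (fm_selection 0 2 3)"
proof -
  \<comment> \<open>For \<open>X = 0\<close>, \<open>T = 2\<close>, \<open>w = 3\<close> the offset
    in \<open>fm_selection\<close> is 5, so its bound variables \<open>s\<close>, \<open>f\<close>,
    \<open>n\<close>, \<open>u\<close>, \<open>a\<close>, \<open>x\<close>, \<open>U\<close> are 6
    to 12.\<close>
  define covers selection where
    "covers = And (fm_fun 6 3) (BAll 8 3 (Forall 9 (Imp (fm_app 6 8 9) (And (fm_sub 9 2) (fm_Union 0 9)))))" and
    "selection = Ex 7 (And (fm_fun 7 3) (And
       (BAll 8 3 (Forall 9 (Forall 10 (Imp (And (fm_app 6 8 9) (fm_app 7 8 10))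
          (And (fm_sub 10 9) (fm_finite 10))))))
       (Forall 11 (Iff (Mem 11 0) (BEx 8 3 (Ex 10 (And (fm_app 7 8 10) (BEx 12 10 (Mem 11 12)))))))))"
  have fm: "fm_selection 0 2 3 = Forall 6 (Imp covers selection)"
    by (simp add: fm_selection_def Let_def covers_def selection_def)
  have "forces P le q (v(6 := s)) selection"
    if s: "name s" and q: "forces P le q (v(6 := s)) covers" for q s
  proof (rule regularI[OF regular_forces])
    fix p assume "p \<preceq> q"
    then have p: "p \<in> elts P" using below_carrier by blast
    have "forces P le p (v(6 := s)) covers" using q \<open>p \<preceq> q\<close> by (rule forces_mono)
    then have cs: "cover_seq X \<tau> p s"
      unfolding covers_def cover_seq_def using s v
      by (simp add: forces_And forces_Forall forces_Imp forces_fun forces_app forces_sub forces_Union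
          del: forces.simps(3-))
    show "\<exists>r. r \<preceq> p \<and> forces P le r (v(6 := s)) selection"
    proof (rule generic_selection[OF top M cs p models[OF p]])
      fix p1 and D :: "nat \<Rightarrow> nat \<Rightarrow> ('v \<times> 'v \<times> 'v) set"
      assume p1: "p1 \<preceq> p" and fin: "\<And>m n. finite (D m n)"
        and sel: "\<And>m n t y V. (t, y, V) \<in> D m n \<Longrightarrow> V \<in> elts \<tau> \<and> selects s t n y V"
        and cov: "\<And>q x. q \<preceq> p1 \<Longrightarrow> x \<in> elts X \<Longrightarrow>
          \<exists>r m n t y V. m \<le> n \<and> (t, y, V) \<in> D m n \<and> x \<in> elts V \<and> r \<preceq> t \<and> r \<preceq> q"
      have fs: "ffun p s (check P om)" using cs unfolding cover_seq_def by blast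
      have name_sel: "name y" if "(t, y, V) \<in> D m n" for t y V m n
        using sel[OF that] unfolding selects_def by blast
      have fmem_sel: "fmem r c (selector_name D n) \<longleftrightarrow>
        dense r (\<lambda>r. \<exists>m t y V. m \<le> n \<and> (t, y, V) \<in> D m n \<and> r \<preceq> t \<and> feq r c y)" for r c n
        by (rule fmem_selector_name) (rule fin)
      have names: "name (selector_name D n)" for n
        unfolding selector_name_def using name_sel
        by (intro name_mkname small_finite finite_selector_names fin) blast
      define f where "f = fnn om (selector_name D \<circ> inv nat_of)"
      have inv: "inv nat_of (nat_of i :: 'v) = i" for i
        using inj_nat_of by (rule inv_f_f)
      have f: "name f" "ffun p1 f (check P om)"
        unfolding f_def using names by (simp_all add: name_fnn ffun_fnn)
      have app_f: "fmem r (pairn (ncheck n) a) f \<longleftrightarrow> feq r a (selector_name D n)" for r n a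
        unfolding f_def by (subst fmem_fnn) (simp_all add: elts_omega inv)
      have app_f': "feq r a (selector_name D k)"
        if "feq r n (ncheck k)" "fmem r (pairn n a) f" for r n a k
        using that feq_pairn_iff feq_refl fmem_cong_left app_f by blast
      \<comment> \<open>A selected \<open>y\<close> has a witness \<open>t\<close> forcing it into
        some value \<open>w\<close> of \<open>s\<close> at \<open>k\<close>. Below both
        \<open>t\<close> and \<open>p\<close>, this \<open>w\<close> equals the given value
        \<open>u\<close>.\<close>
      have member: "fmem q c u"
        if q: "q \<preceq> p1" and n: "name n" "fmem q n (check P om)" and u: "name u" "fmem q (pairn n u) s"
          and a: "fmem q (pairn n a) f" "fmem q c a" for q n u a c
      proof (rule regularI[OF regular_fmem])
        fix q' assume "q' \<preceq> q"
        with n(2) obtain q1 k where q1: "q1 \<preceq> q'" "feq q1 n (ncheck k)" by (rule ncheck_omE)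
        have "q1 \<preceq> q" using q1(1) \<open>q' \<preceq> q\<close> by (rule below_trans)
        then have "feq q1 a (selector_name D k)" using app_f'[OF q1(2)] a(1) fmem_mono by blast
        then have "fmem q1 c (selector_name D k)"
          using fmem_cong_right fmem_mono[OF a(2) \<open>q1 \<preceq> q\<close>] by blast
        then obtain q2 m t y V where q2: "q2 \<preceq> q1" "(t, y, V) \<in> D m k" "q2 \<preceq> t" "feq q2 c y"
          unfolding fmem_sel using below_refl'[OF q1(1)] by (blast elim: denseE)
        obtain w where w: "name w" "fmem t (pairn (ncheck k) w) s" "fmem t y w"
          using sel[OF q2(2)] unfolding selects_def by blast
        have "q2 \<preceq> q" using q2(1) \<open>q1 \<preceq> q\<close> by (rule below_trans)
        have "feq q2 (pairn n u) (pairn (ncheck k) u)"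
          using feq_mono[OF q1(2) q2(1)] feq_refl by (simp add: feq_pairn_iff)
        then have "fmem q2 (pairn (ncheck k) u) s"
          using fmem_mono[OF u(2) \<open>q2 \<preceq> q\<close>] by (rule fmem_cong_left)
        moreover have "q2 \<preceq> p" using \<open>q2 \<preceq> q\<close> q p1 by (blast intro: below_trans)
        ultimately have "feq q2 w u"
          using fmem_mono[OF w(2) q2(3)] w(1) u(1)
          by (intro ffun_unique[OF fs _ fmem_ncheck_om]) simp_all
        then have "fmem q2 y u" using fmem_mono[OF w(3) q2(3)] by (rule fmem_cong_right)
        then have "fmem q2 c u" using feq_sym[OF q2(4)] fmem_cong_left by blast
        then show "\<exists>r. r \<preceq> q' \<and> fmem r c u" using below_trans[OF q2(1) q1(1)] by blast
      qed
      \<comment> \<open>Once \<open>n\<close> is decided to be \<open>k\<close>, the value is forced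
        equal to a selector name, to which \<open>forces_finite\<close> applies.\<close>
      have finite: "forces P le q w (fm_finite 10)"
        if n: "fmem q n (check P om)" and a: "fmem q (pairn n (w 10)) f" for q n w
      proof (rule regularI[OF regular_forces])
        fix q' assume q': "q' \<preceq> q"
        with n obtain r k where r: "r \<preceq> q'" "feq r n (ncheck k)" by (rule ncheck_omE)
        have "r \<preceq> q" using r(1) q' by (rule below_trans)
        then have "feq r (w 10) (selector_name D k)" using app_f'[OF r(2)] a fmem_mono by blast
        then have "forces P le r w (fm_finite 10) \<longleftrightarrow>
            forces P le r (w(10 := selector_name D k)) (fm_finite 10)"
          by (intro forces_cong) (simp add: feq_refl)
        moreover have "forces P le r (w(10 := selector_name D k)) (fm_finite 10)"
          using name_sel by (intro forces_finite[OF finite_selector_names[where D = D and n = k, OF fin]])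
            (auto simp: selector_name_def)
        ultimately show "\<exists>r. r \<preceq> q' \<and> forces P le r w (fm_finite 10)" using r(1) by blast
      qed
      have cover1: "dense q (\<lambda>r. \<exists>n. name n \<and> fmem r n (check P om) \<and>
          dense r (\<lambda>r. \<exists>a. name a \<and> fmem r (pairn n a) f \<and>
            dense r (\<lambda>r. \<exists>U. name U \<and> fmem r U a \<and> fmem r x U)))"
        if q: "q \<preceq> p1" and x: "fmem q x (check P X)" for q x
      proof (rule denseI)
        fix q' assume "q' \<preceq> q"
        with x obtain q1 x0 where q1: "q1 \<preceq> q'" "x0 \<in> elts X" "feq q1 x (check P x0)"
          by (rule fmem_checkE)
        have "q1 \<preceq> p1" using q1(1) \<open>q' \<preceq> q\<close> q by (blast intro: below_trans)
        \<comment> \<open>Predensity yields \<open>r\<close> below both the current condition and a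
          witness \<open>t\<close> for \<open>x0\<close>: \<open>r\<close> puts \<open>y\<close>
          into the selection at \<open>n\<close>, and \<open>x\<close> into
          \<open>y\<close>.\<close>
        then obtain r m n t y V where r: "m \<le> n" "(t, y, V) \<in> D m n" "x0 \<in> elts V" "r \<preceq> t" "r \<preceq> q1"
          using cov q1(2) by blast
        have "fsub t (check P V) y" using sel[OF r(2)] unfolding selects_def by blast
        moreover have "fmem r (check P x0) (check P V)" using r(3) feq_refl by (rule fmem_checkI)
        ultimately have "fmem r (check P x0) y" using fsubD name_check r(4) by blast
        then have xy: "fmem r x y" using feq_sym[OF feq_mono[OF q1(3) r(5)]] fmem_cong_left by blast
        have ya: "fmem r y (selector_name D n)"
          unfolding fmem_sel by (rule dense_all) (meson r(1,2,4) below_trans feq_refl)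
        have "dense r (\<lambda>r. \<exists>a. name a \<and> fmem r (pairn (ncheck n) a) f \<and>
            dense r (\<lambda>r. \<exists>U. name U \<and> fmem r U a \<and> fmem r x U))"
        proof (rule dense_all, intro exI[of _ "selector_name D n"] conjI names)
          fix r' assume r': "r' \<preceq> r"
          show "fmem r' (pairn (ncheck n) (selector_name D n)) f"
            unfolding app_f by (rule feq_refl)
          have "fmem r'' y (selector_name D n)" "fmem r'' x y" if "r'' \<preceq> r'" for r''
            using fmem_mono[OF xy] fmem_mono[OF ya] below_trans[OF that r'] by blast+
          then show "dense r' (\<lambda>r. \<exists>U. name U \<and> fmem r U (selector_name D n) \<and> fmem r x U)"
            using name_sel[OF r(2)] by (intro dense_all) blast
        qed
        then show "\<exists>r. r \<preceq> q' \<and> (\<exists>n. name n \<and> fmem r n (check P om) \<and>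
            dense r (\<lambda>r. \<exists>a. name a \<and> fmem r (pairn n a) f \<and>
              dense r (\<lambda>r. \<exists>U. name U \<and> fmem r U a \<and> fmem r x U)))"
          using below_trans[OF r(5) q1(1)] fmem_ncheck_om[of r n] name_check by blast
      qed
      \<comment> \<open>By \<open>member\<close>, \<open>U\<close> belongs to a cover from
        \<open>s\<close>, whose union is forced to be \<open>X\<close>.\<close>
      have in_X: "fmem q x (check P X)"
        if q: "q \<preceq> p1" and n: "name n" "fmem q n (check P om)" and a: "fmem q (pairn n a) f"
          and U: "name U" "fmem q U a" and x: "name x" "fmem q x U" for q n a U x
      proof (rule regularI[OF regular_fmem])
        fix q' assume q': "q' \<preceq> q"
        have "q \<preceq> p" using q p1 by (rule below_trans)
        then have "dense q (\<lambda>r. \<exists>u. name u \<and> fmem r (pairn n u) s \<and>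
            (\<forall>y' r'. name y' \<longrightarrow> r' \<preceq> r \<longrightarrow> fmem r' (pairn n y') s \<longrightarrow> feq r' y' u))"
          using fs n unfolding ffun_def by blast
        then obtain r u where r: "r \<preceq> q'" "name u" "fmem r (pairn n u) s"
          using q' by (blast elim: denseE)
        have rq: "r \<preceq> q" using r(1) q' by (rule below_trans)
        have "fmem r U u"
          using member[OF below_trans[OF rq q] n(1) fmem_mono[OF n(2) rq] r(2,3)
            fmem_mono[OF a rq] fmem_mono[OF U(2) rq]] .
        moreover have "fUnion r (check P X) u"
          using cs n r(2,3) rq \<open>q \<preceq> p\<close> unfolding cover_seq_def by blast
        ultimately have "fmem r x (check P X)"
          using fUnionI[OF _ x(1) below_refl'[OF r(1)] U(1)] fmem_mono[OF x(2) rq] by blast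
        then show "\<exists>r. r \<preceq> q' \<and> fmem r x (check P X)" using r(1) by blast
      qed
      \<comment> \<open>Three existential quantifiers are peeled off; regularity of membership
        removes the density of each before \<open>in_X\<close> applies.\<close>
      have cover2: "fmem q x (check P X)"
        if q: "q \<preceq> p1" and x: "name x" and ex: "dense q (\<lambda>r. \<exists>n. name n \<and> fmem r n (check P om) \<and>
          dense r (\<lambda>r. \<exists>a. name a \<and> fmem r (pairn n a) f \<and>
            dense r (\<lambda>r. \<exists>U. name U \<and> fmem r U a \<and> fmem r x U)))" for q x
      proof (rule regular_dense_use[OF regular_fmem ex], elim exE conjE)
        fix r n assume r: "r \<preceq> q" and n: "name n" "fmem r n (check P om)"
          and ex: "dense r (\<lambda>r. \<exists>a. name a \<and> fmem r (pairn n a) f \<and>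
            dense r (\<lambda>r. \<exists>U. name U \<and> fmem r U a \<and> fmem r x U))"
        show "fmem r x (check P X)"
        proof (rule regular_dense_use[OF regular_fmem ex], elim exE conjE)
          fix r' a assume r': "r' \<preceq> r" and a: "fmem r' (pairn n a) f"
            and ex: "dense r' (\<lambda>r. \<exists>U. name U \<and> fmem r U a \<and> fmem r x U)"
          show "fmem r' x (check P X)"
          proof (rule regular_dense_use[OF regular_fmem ex], elim exE conjE)
            fix r'' U assume r'': "r'' \<preceq> r'" and U: "name U" "fmem r'' U a" "fmem r'' x U"
            have "r'' \<preceq> r" using r'' r' by (rule below_trans)
            then have "r'' \<preceq> p1" "fmem r'' n (check P om)"
              using r q n(2) below_trans fmem_mono by blast+
            then show "fmem r'' x (check P X)"
              using in_X[OF _ n(1) _ fmem_mono[OF a r''] U(1,2) x U(3)] by blast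
          qed
        qed
      qed
      define w where "w = v(6 := s, 7 := f)"
      have w: "w 0 = check P X" "w 3 = check P om" "w 6 = s" "w 7 = f"
        using v by (simp_all add: w_def)
      have "forces P le p1 w (BAll 8 3 (Forall 9 (Forall 10 (Imp (And (fm_app 6 8 9) (fm_app 7 8 10))
            (And (fm_sub 10 9) (fm_finite 10))))))"
        unfolding forces_Forall forces_Imp forces_And
      proof (intro allI impI)
        fix n q u a r
        assume n: "name n" "q \<preceq> p1" "forces P le q (w(8 := n)) (Mem 8 3)" and u: "name u" and a: "name a"
          and r: "r \<preceq> q" "forces P le r (w(8 := n, 9 := u, 10 := a)) (fm_app 6 8 9) \<and>
            forces P le r (w(8 := n, 9 := u, 10 := a)) (fm_app 7 8 10)"
        have nr: "fmem r n (check P om)" using n(3) r(1) w fmem_mono by simp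
        have app: "fmem r (pairn n u) s" "fmem r (pairn n a) f"
          using r(2) n(1) u a w by (simp_all add: forces_app)
        have "r \<preceq> p1" using r(1) n(2) by (rule below_trans)
        have "fsub r a u"
          unfolding fsub_def
        proof (intro allI impI)
          fix c r' assume r': "r' \<preceq> r" and c: "fmem r' c a"
          show "fmem r' c u"
            by (rule member[OF below_trans[OF r' \<open>r \<preceq> p1\<close>] n(1) fmem_mono[OF nr r'] u
                  fmem_mono[OF app(1) r'] fmem_mono[OF app(2) r'] c])
        qed
        then show "forces P le r (w(8 := n, 9 := u, 10 := a)) (fm_sub 10 9) \<and>
            forces P le r (w(8 := n, 9 := u, 10 := a)) (fm_finite 10)"
          using finite[OF nr, of "w(8 := n, 9 := u, 10 := a)"] app(2) by (simp add: forces_sub)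
      qed
      moreover have "forces P le p1 w (Forall 11 (Iff (Mem 11 0)
          (BEx 8 3 (Ex 10 (And (fm_app 7 8 10) (BEx 12 10 (Mem 11 12)))))))"
        unfolding forces_Forall forces_Iff
      proof (intro allI impI)
        fix x q assume x: "name x" "q \<preceq> p1"
        have "forces P le q (w(11 := x)) (BEx 8 3 (Ex 10 (And (fm_app 7 8 10) (BEx 12 10 (Mem 11 12)))))
          \<longleftrightarrow> dense q (\<lambda>r. \<exists>n. name n \<and> fmem r n (check P om) \<and>
            dense r (\<lambda>r. \<exists>a. name a \<and> fmem r (pairn n a) f \<and>
              dense r (\<lambda>r. \<exists>U. name U \<and> fmem r U a \<and> fmem r x U)))"
          using w by (simp add: forces_Ex forces_And forces_app cong: conj_cong del: forces.simps(3-))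
        then show "forces P le q (w(11 := x)) (Mem 11 0) \<longleftrightarrow>
            forces P le q (w(11 := x)) (BEx 8 3 (Ex 10 (And (fm_app 7 8 10) (BEx 12 10 (Mem 11 12)))))"
          using cover1[OF x(2)] cover2[OF x(2,1)] w by auto
      qed
      moreover have "forces P le p1 w (fm_fun 7 3)" using f(2) w by (simp add: forces_fun)
      ultimately have "forces P le p1 (v(6 := s)) selection"
        unfolding selection_def w_def by (intro forces_ExI[OF f(1)]) (simp only: forces_And)
      then show "\<exists>r. r \<preceq> p \<and> forces P le r (v(6 := s)) selection" using p1 by blast
    qed
  qed
  then show ?thesis
    unfolding fm forces_Forall forces_Imp by blast
qed

section \<open>Assembling the Menger formula\<close>

lemma forces_MengerI:
  assumes top: "is_top_space X \<tau>" and M: "Menger_space (space_of \<tau>)"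
    and models: "\<And>p. p \<in> elts P \<Longrightarrow> strongly_proper_often p"
  shows "forces_Menger P le X \<tau>"
  unfolding forces_Menger_def
proof
  fix p assume "p \<in> elts P"
  \<comment> \<open>With arguments 0 and 1, the topology and omega receive the variables 2 and 3;
    \<open>topn\<close> and \<open>check P om\<close> are their witnesses.\<close>
  have fm: "fm_Menger 0 1 = Ex 2 (Ex 3 (And (fm_topology_with_basis 2 1)
      (And (fm_omega 3) (fm_selection 0 2 3))))"
    by (simp add: fm_Menger_def Let_def numeral_2_eq_2 numeral_3_eq_3)
  have tX: "\<Union>(elts ` elts \<tau>) \<subseteq> elts X" using top unfolding is_top_space_def by blast
  let ?v = "(val2 (check P X) (check P \<tau>))(2 := topn X \<tau>, 3 := check P om)"
  have "forces P le p ?v (fm_topology_with_basis 2 1)"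
    by (rule forces_topology_with_basis[OF tX]) (simp_all add: val2_def)
  moreover have "forces P le p ?v (fm_omega 3)" by (rule forces_omega) simp
  moreover have "forces P le p ?v (fm_selection 0 2 3)"
    by (rule forces_fm_selection[OF top M _ _ _ models]) (simp_all add: val2_def)
  ultimately have "forces P le p ?v (And (fm_topology_with_basis 2 1)
      (And (fm_omega 3) (fm_selection 0 2 3)))"
    unfolding forces_And by blast
  then show "forces P le p (val2 (check P X) (check P \<tau>)) (fm_Menger 0 1)"
    unfolding fm by (intro forces_ExI[OF name_topn] forces_ExI[OF name_check])
qed

end

section \<open>From stationarity to closed models\<close>

theorem theorem5p7:
  fixes \<theta> X \<tau> P le :: "'v::zfc"
  assumes "regular_cardinal \<theta>" and "large_enough \<theta> P X"
    and "is_top_space X \<tau>" and "pair X \<tau> \<in> H \<theta>" and "Menger_space (space_of \<tau>)"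
    and "poset P le" and "pair P le \<in> H \<theta>"
    and "stationary_in (H \<theta>)
           {M \<in> ctbl_subsets (H \<theta>). elem_submodel M (H \<theta>) \<and> pair P le \<in> M \<and>
              strongly_proper_for P le M}"
  shows "forces_Menger P le X \<tau>"
proof -
  interpret forcing_poset P le using assms(6) by unfold_locales
  show ?thesis
  proof (rule forces_MengerI[OF assms(3,5)], unfold strongly_proper_often_def, intro allI impI)
    fix p c assume p: "p \<in> elts P" and c: "\<forall>r\<in>elts P. countable (c r) \<and> c r \<subseteq> elts P"
    \<comment> \<open>Adding \<open>p\<close> to every value makes each nonempty closed set contain
      \<open>p\<close>. Outside \<open>P\<close>, where \<open>c\<close> is unconstrained, the value
      is just \<open>{p}\<close>.\<close>
    define c' where "c' r = insert p (if r \<in> elts P then c r else {})" for r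
    have "club_in (H \<theta>) {N \<in> ctbl_subsets (H \<theta>). \<forall>r\<in>N. c' r \<subseteq> N}"
    proof (rule club_closure_points)
      show "countable (c' r)" "c' r \<subseteq> H \<theta>" for r
        using c p elts_subset_H[OF assms(7)] unfolding c'_def by auto
    qed
    \<comment> \<open>The stationary set meets the club of sets closed under
      \<open>c'\<close>.\<close>
    then obtain N where N: "N \<in> ctbl_subsets (H \<theta>)" "\<And>r. r \<in> N \<Longrightarrow> c' r \<subseteq> N" "strongly_proper_for P le N"
      using assms(8) unfolding stationary_in_def by blast
    have "N \<noteq> {}" "countable N" using N(1) by (auto simp: ctbl_subsets_def)
    then show "\<exists>N. countable N \<and> p \<in> N \<and> (\<forall>r\<in>N \<inter> elts P. c r \<subseteq> N) \<and> strongly_proper_for P le N"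
      using N(2,3) unfolding c'_def by (intro exI[of _ N]) fastforce
  qed
qed

end
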